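(* Let $(S,g_0)$ be a compact Riemannian manifold endowed with a non-trivial periodic Killing vector field $Y$, and let $\omega$ be a one-form on $S$ such that $\omega(Y)<0$ is constant and $L_Y\omega=0$. Then there exist at least two closed (non-trivial) geodesics of the Kropina metric $K(v)=-\frac{g_0(v,v)}{2\omega(v)}$.
   Context: $S$ is a connected smooth manifold (without boundary) of dimension at least $2$; $g_0,\omega,Y$ are smooth. A Killing vector field is periodic if all its orbits are closed. $L_Y$ is the Lie derivative. The Kropina metric $K(v)=-\frac{g_0(v,v)}{2\omega(v)}$ is defined (and positive) on $\mathcal A=\{v\in TS:\ -\omega(v)>0\}$. $\Omega(\mathcal A)$ is the set of continuous, piecewise smooth curves $\gamma:[0,1]\to S$ with $\gamma(0)=\gamma(1)$ whose left and right derivatives belong to $\mathcal A$ for every $s\in[0,1]$ (at $s=0$ and $s=1$ understood periodically). A closed geodesic of $(S,K)$ is a critical point of the energy $E(\gamma)=\frac12\int_0^1K^2(\dot\gamma)\,ds$ on $\Omega(\mathcal A)$. Two closed geodesics that differ only by a reparametrization are not counted as different. *)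

theory Defs
  imports "HOL-Analysis.Analysis"
begin

section \<open>Smooth maps between Euclidean spaces\<close>

primrec Ck_on :: "nat \<Rightarrow> 'a::euclidean_space set \<Rightarrow> ('a \<Rightarrow> 'b::euclidean_space) \<Rightarrow> bool" where
  "Ck_on 0 U f \<longleftrightarrow> continuous_on U f"
| "Ck_on (Suc k) U f \<longleftrightarrow> (\<forall>x\<in>U. f differentiable (at x)) \<and>
     (\<forall>v. Ck_on k U (\<lambda>x. frechet_derivative f (at x) v))"

text \<open>On an arbitrary set (a closed interval, say), smoothness means that there are local smooth
  extensions to open sets. On an open set this is ordinary smoothness.\<close>

definition smooth_on :: "'a::euclidean_space set \<Rightarrow> ('a \<Rightarrow> 'b::euclidean_space) \<Rightarrow> bool" where
  "smooth_on X f \<longleftrightarrow> (\<forall>x\<in>X. \<exists>U F. open U \<and> x \<in> U \<and> (\<forall>k. Ck_on k U F) \<and> (\<forall>y\<in>X \<inter> U. F y = f y))"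

section \<open>Smooth manifolds\<close>

text \<open>A chart is a pair of a domain in the manifold and a coordinate map (only its values on the
  domain matter) onto an open subset of the model space.\<close>

type_synonym ('a, 'b) chart = "'a set \<times> ('a \<Rightarrow> 'b)"

abbreviation chart_dom :: "('a, 'b) chart \<Rightarrow> 'a set" where "chart_dom \<equiv> fst"

abbreviation coord :: "('a, 'b) chart \<Rightarrow> 'a \<Rightarrow> 'b" where "coord \<equiv> snd"

definition chart_img :: "('a, 'b) chart \<Rightarrow> 'b set" where
  "chart_img c = coord c ` chart_dom c"

definition chart_inv :: "('a, 'b) chart \<Rightarrow> 'b \<Rightarrow> 'a" where
  "chart_inv c = the_inv_into (chart_dom c) (coord c)"

text \<open>The manifold is the set \<open>S\<close> with its subspace topology and the smooth structure generated by
  the atlas \<open>\<A>\<close>; its dimension is that of the model space \<open>'b\<close>, and it has no boundary.\<close>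

definition smooth_manifold ::
  "'a::topological_space set \<Rightarrow> ('a, 'b::euclidean_space) chart set \<Rightarrow> bool" where
  "smooth_manifold S \<A> \<longleftrightarrow>
     Hausdorff_space (top_of_set S) \<and> second_countable (top_of_set S) \<and>
     (\<Union>c\<in>\<A>. chart_dom c) = S \<and>
     (\<forall>c\<in>\<A>. openin (top_of_set S) (chart_dom c) \<and> open (chart_img c) \<and>
        homeomorphism (chart_dom c) (chart_img c) (coord c) (chart_inv c)) \<and>
     (\<forall>c\<in>\<A>. \<forall>c'\<in>\<A>. smooth_on (coord c ` (chart_dom c \<inter> chart_dom c')) (coord c' \<circ> chart_inv c))"

definition smooth_into ::
  "'a::topological_space set \<Rightarrow> ('a, 'b::euclidean_space) chart set \<Rightarrow>
   'c::euclidean_space set \<Rightarrow> ('c \<Rightarrow> 'a) \<Rightarrow> bool" where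
  "smooth_into S \<A> X f \<longleftrightarrow> f ` X \<subseteq> S \<and> continuous_on X f \<and>
     (\<forall>c\<in>\<A>. smooth_on {x \<in> X. f x \<in> chart_dom c} (coord c \<circ> f))"

section \<open>Tangent vectors and tensor fields\<close>

text \<open>A tangent vector at \<open>p\<close> is the family of its components with respect to all charts around \<open>p\<close>,
  related by the derivatives of the coordinate changes. Components with respect to other charts are
  fixed to be 0, so that equality of tangent vectors is equality of functions.\<close>

type_synonym ('a, 'b) tangent = "('a, 'b) chart \<Rightarrow> 'b"

definition tangent_space ::
  "('a, 'b::euclidean_space) chart set \<Rightarrow> 'a \<Rightarrow> ('a, 'b) tangent set" where
  "tangent_space \<A> p = {v.
     (\<forall>c. \<not> (c \<in> \<A> \<and> p \<in> chart_dom c) \<longrightarrow> v c = 0) \<and>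
     (\<forall>c\<in>\<A>. \<forall>c'\<in>\<A>. p \<in> chart_dom c \<inter> chart_dom c' \<longrightarrow>
        v c' = frechet_derivative (coord c' \<circ> chart_inv c) (at (coord c p)) (v c))}"

text \<open>The tangent vector at \<open>p\<close> whose component in the chart \<open>c\<close> around \<open>p\<close> is \<open>u\<close>.\<close>

definition chart_vec ::
  "('a, 'b::euclidean_space) chart set \<Rightarrow> ('a, 'b) chart \<Rightarrow> 'a \<Rightarrow> 'b \<Rightarrow> ('a, 'b) tangent" where
  "chart_vec \<A> c p u = (\<lambda>c'. if c' \<in> \<A> \<and> p \<in> chart_dom c'
     then frechet_derivative (coord c' \<circ> chart_inv c) (at (coord c p)) u else 0)"

text \<open>Local coordinate expressions of vector fields, one-forms and (0,2)-tensor fields.\<close>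

definition vec_rep ::
  "('a, 'b) chart \<Rightarrow> ('a \<Rightarrow> ('a, 'b) tangent) \<Rightarrow> 'b \<Rightarrow> 'b" where
  "vec_rep c Y x = Y (chart_inv c x) c"

definition form_rep ::
  "('a, 'b::euclidean_space) chart set \<Rightarrow> ('a, 'b) chart \<Rightarrow>
   ('a \<Rightarrow> ('a, 'b) tangent \<Rightarrow> real) \<Rightarrow> 'b \<Rightarrow> 'b \<Rightarrow> real" where
  "form_rep \<A> c \<omega> x u = \<omega> (chart_inv c x) (chart_vec \<A> c (chart_inv c x) u)"

definition metric_rep ::
  "('a, 'b::euclidean_space) chart set \<Rightarrow> ('a, 'b) chart \<Rightarrow>
   ('a \<Rightarrow> ('a, 'b) tangent \<Rightarrow> ('a, 'b) tangent \<Rightarrow> real) \<Rightarrow> 'b \<Rightarrow> 'b \<Rightarrow> 'b \<Rightarrow> real" where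
  "metric_rep \<A> c g x u w =
     g (chart_inv c x) (chart_vec \<A> c (chart_inv c x) u) (chart_vec \<A> c (chart_inv c x) w)"

definition smooth_vector_field ::
  "'a set \<Rightarrow> ('a, 'b::euclidean_space) chart set \<Rightarrow> ('a \<Rightarrow> ('a, 'b) tangent) \<Rightarrow> bool" where
  "smooth_vector_field S \<A> Y \<longleftrightarrow> (\<forall>p\<in>S. Y p \<in> tangent_space \<A> p) \<and>
     (\<forall>c\<in>\<A>. smooth_on (chart_img c) (vec_rep c Y))"

definition linear_on_tangent ::
  "('a, 'b::euclidean_space) chart set \<Rightarrow> 'a \<Rightarrow> (('a, 'b) tangent \<Rightarrow> real) \<Rightarrow> bool" where
  "linear_on_tangent \<A> p l \<longleftrightarrow> (\<forall>v\<in>tangent_space \<A> p. \<forall>w\<in>tangent_space \<A> p. \<forall>a b.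
     l (\<lambda>c. a *\<^sub>R v c + b *\<^sub>R w c) = a * l v + b * l w)"

definition smooth_one_form ::
  "'a set \<Rightarrow> ('a, 'b::euclidean_space) chart set \<Rightarrow> ('a \<Rightarrow> ('a, 'b) tangent \<Rightarrow> real) \<Rightarrow> bool" where
  "smooth_one_form S \<A> \<omega> \<longleftrightarrow> (\<forall>p\<in>S. linear_on_tangent \<A> p (\<omega> p)) \<and>
     (\<forall>c\<in>\<A>. \<forall>u. smooth_on (chart_img c) (\<lambda>x. form_rep \<A> c \<omega> x u))"

definition riemannian_metric ::
  "'a set \<Rightarrow> ('a, 'b::euclidean_space) chart set \<Rightarrow>
   ('a \<Rightarrow> ('a, 'b) tangent \<Rightarrow> ('a, 'b) tangent \<Rightarrow> real) \<Rightarrow> bool" where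
  "riemannian_metric S \<A> g \<longleftrightarrow>
     (\<forall>p\<in>S. \<forall>v\<in>tangent_space \<A> p. linear_on_tangent \<A> p (g p v) \<and>
        (\<forall>w\<in>tangent_space \<A> p. g p v w = g p w v) \<and>
        (v \<noteq> (\<lambda>c. 0) \<longrightarrow> g p v v > 0)) \<and>
     (\<forall>c\<in>\<A>. \<forall>u w. smooth_on (chart_img c) (\<lambda>x. metric_rep \<A> c g x u w))"

section \<open>Lie derivatives, Killing fields and their orbits\<close>

text \<open>Coordinate expressions of \<open>L\<^sub>Y \<omega>\<close> and \<open>L\<^sub>Y g\<close>; in index notation
  \<open>Y\<^sup>k \<partial>\<^sub>k \<omega>\<^sub>i + \<omega>\<^sub>k \<partial>\<^sub>i Y\<^sup>k\<close> and
  \<open>Y\<^sup>k \<partial>\<^sub>k g\<^sub>i\<^sub>j + g\<^sub>k\<^sub>j \<partial>\<^sub>i Y\<^sup>k + g\<^sub>i\<^sub>k \<partial>\<^sub>j Y\<^sup>k\<close>.\<close>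

definition lie_form_rep ::
  "('a, 'b::euclidean_space) chart set \<Rightarrow> ('a, 'b) chart \<Rightarrow> ('a \<Rightarrow> ('a, 'b) tangent) \<Rightarrow>
   ('a \<Rightarrow> ('a, 'b) tangent \<Rightarrow> real) \<Rightarrow> 'b \<Rightarrow> 'b \<Rightarrow> real" where
  "lie_form_rep \<A> c Y \<omega> x u =
     frechet_derivative (\<lambda>y. form_rep \<A> c \<omega> y u) (at x) (vec_rep c Y x) +
     form_rep \<A> c \<omega> x (frechet_derivative (vec_rep c Y) (at x) u)"

definition lie_metric_rep ::
  "('a, 'b::euclidean_space) chart set \<Rightarrow> ('a, 'b) chart \<Rightarrow> ('a \<Rightarrow> ('a, 'b) tangent) \<Rightarrow>
   ('a \<Rightarrow> ('a, 'b) tangent \<Rightarrow> ('a, 'b) tangent \<Rightarrow> real) \<Rightarrow> 'b \<Rightarrow> 'b \<Rightarrow> 'b \<Rightarrow> real" where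
  "lie_metric_rep \<A> c Y g x u w =
     frechet_derivative (\<lambda>y. metric_rep \<A> c g y u w) (at x) (vec_rep c Y x) +
     metric_rep \<A> c g x (frechet_derivative (vec_rep c Y) (at x) u) w +
     metric_rep \<A> c g x u (frechet_derivative (vec_rep c Y) (at x) w)"

definition lie_form_zero ::
  "('a, 'b::euclidean_space) chart set \<Rightarrow> ('a \<Rightarrow> ('a, 'b) tangent) \<Rightarrow>
   ('a \<Rightarrow> ('a, 'b) tangent \<Rightarrow> real) \<Rightarrow> bool" where
  "lie_form_zero \<A> Y \<omega> \<longleftrightarrow> (\<forall>c\<in>\<A>. \<forall>x\<in>chart_img c. \<forall>u. lie_form_rep \<A> c Y \<omega> x u = 0)"

definition killing_field ::
  "'a set \<Rightarrow> ('a, 'b::euclidean_space) chart set \<Rightarrow>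
   ('a \<Rightarrow> ('a, 'b) tangent \<Rightarrow> ('a, 'b) tangent \<Rightarrow> real) \<Rightarrow> ('a \<Rightarrow> ('a, 'b) tangent) \<Rightarrow> bool" where
  "killing_field S \<A> g Y \<longleftrightarrow> smooth_vector_field S \<A> Y \<and>
     (\<forall>c\<in>\<A>. \<forall>x\<in>chart_img c. \<forall>u w. lie_metric_rep \<A> c Y g x u w = 0)"

text \<open>The curve \<open>\<gamma>\<close>, restricted to \<open>T\<close>, has the tangent vector \<open>v\<close> at parameter \<open>t\<close>; taking
  \<open>T = {t..}\<close> and \<open>T = {..t}\<close> gives right and left derivatives. To be used for continuous curves.\<close>

definition has_velocity ::
  "('a, 'b::euclidean_space) chart set \<Rightarrow> (real \<Rightarrow> 'a) \<Rightarrow> ('a, 'b) tangent \<Rightarrow> real \<Rightarrow> real set \<Rightarrow> bool" where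
  "has_velocity \<A> \<gamma> v t T \<longleftrightarrow> v \<in> tangent_space \<A> (\<gamma> t) \<and>
     (\<forall>c\<in>\<A>. \<gamma> t \<in> chart_dom c \<longrightarrow> ((coord c \<circ> \<gamma>) has_vector_derivative v c) (at t within T))"

definition complete_integral_curve ::
  "'a::topological_space set \<Rightarrow> ('a, 'b::euclidean_space) chart set \<Rightarrow>
   ('a \<Rightarrow> ('a, 'b) tangent) \<Rightarrow> (real \<Rightarrow> 'a) \<Rightarrow> bool" where
  "complete_integral_curve S \<A> Y \<gamma> \<longleftrightarrow> range \<gamma> \<subseteq> S \<and> continuous_on UNIV \<gamma> \<and>
     (\<forall>t. has_velocity \<A> \<gamma> (Y (\<gamma> t)) t UNIV)"

text \<open>All orbits are closed. The period may depend on the orbit; fixed points count as closed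
  orbits.\<close>

definition periodic_field ::
  "'a::topological_space set \<Rightarrow> ('a, 'b::euclidean_space) chart set \<Rightarrow>
   ('a \<Rightarrow> ('a, 'b) tangent) \<Rightarrow> bool" where
  "periodic_field S \<A> Y \<longleftrightarrow> (\<forall>p\<in>S. \<exists>\<gamma>. complete_integral_curve S \<A> Y \<gamma> \<and> \<gamma> 0 = p \<and>
     (\<exists>T>0. \<forall>t. \<gamma> (t + T) = \<gamma> t))"

section \<open>Kropina metrics and their closed geodesics\<close>

definition kropina ::
  "('a \<Rightarrow> ('a, 'b) tangent \<Rightarrow> ('a, 'b) tangent \<Rightarrow> real) \<Rightarrow> ('a \<Rightarrow> ('a, 'b) tangent \<Rightarrow> real) \<Rightarrow>
   'a \<Rightarrow> ('a, 'b) tangent \<Rightarrow> real" where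
  "kropina g \<omega> p v = - (g p v v / (2 * \<omega> p v))"

definition kropina_domain ::
  "('a, 'b::euclidean_space) chart set \<Rightarrow> ('a \<Rightarrow> ('a, 'b) tangent \<Rightarrow> real) \<Rightarrow>
   'a \<Rightarrow> ('a, 'b) tangent set" where
  "kropina_domain \<A> \<omega> p = {v \<in> tangent_space \<A> p. - \<omega> p v > 0}"

text \<open>Closed curves are functions on the reals of which only the values on \<open>[0,1]\<close> matter.\<close>

definition periodic_ext :: "(real \<Rightarrow> 'a) \<Rightarrow> real \<Rightarrow> 'a" where
  "periodic_ext \<gamma> t = \<gamma> (frac t)"

definition subdivision :: "real set \<Rightarrow> bool" where
  "subdivision P \<longleftrightarrow> finite P \<and> {0, 1} \<subseteq> P \<and> P \<subseteq> {0..1}"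

definition consecutive :: "real set \<Rightarrow> real \<Rightarrow> real \<Rightarrow> bool" where
  "consecutive P a b \<longleftrightarrow> a \<in> P \<and> b \<in> P \<and> a < b \<and> P \<inter> {a<..<b} = {}"

definition piecewise_smooth ::
  "'a::topological_space set \<Rightarrow> ('a, 'b::euclidean_space) chart set \<Rightarrow> (real \<Rightarrow> 'a) \<Rightarrow> bool" where
  "piecewise_smooth S \<A> \<gamma> \<longleftrightarrow>
     (\<exists>P. subdivision P \<and> (\<forall>a b. consecutive P a b \<longrightarrow> smooth_into S \<A> {a..b} \<gamma>))"

definition admissible_loops ::
  "'a::topological_space set \<Rightarrow> ('a, 'b::euclidean_space) chart set \<Rightarrow>
   ('a \<Rightarrow> ('a, 'b) tangent \<Rightarrow> real) \<Rightarrow> (real \<Rightarrow> 'a) set" where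
  "admissible_loops S \<A> \<omega> = {\<gamma>.
     \<gamma> ` {0..1} \<subseteq> S \<and> continuous_on {0..1} \<gamma> \<and> piecewise_smooth S \<A> \<gamma> \<and> \<gamma> 0 = \<gamma> 1 \<and>
     (\<forall>s\<in>{0..1}.
        (\<exists>v\<in>kropina_domain \<A> \<omega> (\<gamma> s). has_velocity \<A> (periodic_ext \<gamma>) v s {..s}) \<and>
        (\<exists>v\<in>kropina_domain \<A> \<omega> (\<gamma> s). has_velocity \<A> (periodic_ext \<gamma>) v s {s..}))}"

text \<open>The tangent vector of a curve on \<open>[0,1]\<close>, meaningful at all but finitely many parameters if
  the curve is piecewise smooth.\<close>

definition velocity ::
  "('a, 'b::euclidean_space) chart set \<Rightarrow> (real \<Rightarrow> 'a) \<Rightarrow> real \<Rightarrow> ('a, 'b) tangent" where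
  "velocity \<A> \<gamma> s = (\<lambda>c. if c \<in> \<A> \<and> \<gamma> s \<in> chart_dom c
     then vector_derivative (coord c \<circ> \<gamma>) (at s within {0..1}) else 0)"

definition kropina_energy ::
  "('a, 'b::euclidean_space) chart set \<Rightarrow>
   ('a \<Rightarrow> ('a, 'b) tangent \<Rightarrow> ('a, 'b) tangent \<Rightarrow> real) \<Rightarrow> ('a \<Rightarrow> ('a, 'b) tangent \<Rightarrow> real) \<Rightarrow>
   (real \<Rightarrow> 'a) \<Rightarrow> real" where
  "kropina_energy \<A> g \<omega> \<gamma> = 1 / 2 * integral {0..1} (\<lambda>s. (kropina g \<omega> (\<gamma> s) (velocity \<A> \<gamma> s))\<^sup>2)"

text \<open>A variation of \<open>\<gamma>\<close> through admissible loops, smooth on \<open>(-\<epsilon>,\<epsilon>) \<times> [a,b]\<close> for consecutive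
  points \<open>a\<close>, \<open>b\<close> of some subdivision of \<open>[0,1]\<close>.\<close>

definition admissible_variation ::
  "'a::topological_space set \<Rightarrow> ('a, 'b::euclidean_space) chart set \<Rightarrow>
   ('a \<Rightarrow> ('a, 'b) tangent \<Rightarrow> real) \<Rightarrow> (real \<Rightarrow> 'a) \<Rightarrow> real \<Rightarrow> (real \<Rightarrow> real \<Rightarrow> 'a) \<Rightarrow> bool" where
  "admissible_variation S \<A> \<omega> \<gamma> \<epsilon> H \<longleftrightarrow>
     (\<forall>s\<in>{0..1}. H 0 s = \<gamma> s) \<and>
     (\<forall>r\<in>{-\<epsilon><..<\<epsilon>}. H r \<in> admissible_loops S \<A> \<omega>) \<and>
     (\<exists>P. subdivision P \<and> (\<forall>a b. consecutive P a b \<longrightarrow>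
        smooth_into S \<A> ({-\<epsilon><..<\<epsilon>} \<times> {a..b}) (\<lambda>(r, s). H r s)))"

text \<open>Critical points of the energy on the space of admissible loops, whose tangent vectors at
  \<open>\<gamma>\<close> are the variation fields of admissible variations of \<open>\<gamma>\<close>.\<close>

definition closed_geodesic ::
  "'a::topological_space set \<Rightarrow> ('a, 'b::euclidean_space) chart set \<Rightarrow>
   ('a \<Rightarrow> ('a, 'b) tangent \<Rightarrow> ('a, 'b) tangent \<Rightarrow> real) \<Rightarrow> ('a \<Rightarrow> ('a, 'b) tangent \<Rightarrow> real) \<Rightarrow>
   (real \<Rightarrow> 'a) \<Rightarrow> bool" where
  "closed_geodesic S \<A> g \<omega> \<gamma> \<longleftrightarrow> \<gamma> \<in> admissible_loops S \<A> \<omega> \<and>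
     (\<forall>\<epsilon>>0. \<forall>H. admissible_variation S \<A> \<omega> \<gamma> \<epsilon> H \<longrightarrow>
        ((\<lambda>r. kropina_energy \<A> g \<omega> (H r)) has_real_derivative 0) (at 0))"

text \<open>Reparametrizations are those of the periodic extensions, so that shifting the base point or
  iterating a closed curve does not produce a different one.\<close>

definition same_up_to_reparametrization :: "(real \<Rightarrow> 'a) \<Rightarrow> (real \<Rightarrow> 'a) \<Rightarrow> bool" where
  "same_up_to_reparametrization \<gamma>\<^sub>1 \<gamma>\<^sub>2 \<longleftrightarrow> (\<exists>\<phi> \<psi>. homeomorphism (UNIV :: real set) (UNIV :: real set) \<phi> \<psi> \<and>
     (\<forall>t. periodic_ext \<gamma>\<^sub>2 t = periodic_ext \<gamma>\<^sub>1 (\<phi> t)))"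

end

theory Submission
  imports Defs
begin

text \<open>The field \<open>Y\<close> preserves the Kropina metric, so an orbit of \<open>Y\<close> is a geodesic as soon as it
  consists of critical points of \<open>f = g\<^sub>0(Y,Y)\<close>, a function which is constant along orbits. For a variation \<open>H\<close>
  of such an orbit with variation field \<open>\<xi>\<close>, the equations \<open>L\<^sub>Y g\<^sub>0 = 0\<close>, \<open>L\<^sub>Y \<omega> = 0\<close>, \<open>df = 0\<close> and
  \<open>\<omega>(Y) = k\<close> turn the first variation of the energy density into the exact derivative
  of a multiple of \<open>- g\<^sub>0(\<xi>,Y) / k + f \<omega>(\<xi>) / (2 k\<^sup>2)\<close> along the loop, which integrates to 0. If \<open>f\<close> is not
  constant, orbits through a maximum and a minimum are two different closed geodesics; if it is constant,
  all orbits are closed geodesics, and no single orbit fills \<open>S\<close> because its dimension is at least 2.\<close>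

section \<open>Differentiability classes\<close>

text \<open>The multiple named above is not guessed: it is the fibre derivative of
  \<open>K^2\<close> at the orbit velocity, applied to \<xi>, so the identity is the Euler-Lagrange
  equation along the orbit. Its \<omega>-part is Cartan's formula i_Y d\<omega> = L_Y \<omega> -
  d(\<omega>(Y)) = 0; its metric part is \<nabla>_Y Y = - grad f / 2 = 0 for a Killing field at
  critical points of f. Both are carried out in charts from the coordinate equations, with neither a
  flow nor a connection. The obstacle is regularity. Competing loops are smooth only on closed
  pieces, through local extensions, and the chart changes along the loop; hence the identity is
  proved at one parameter at a time and then integrated piece by piece. The pieces fit together
  because \<xi>(s) is a derivative in r alone, so it is single-valued at corners and agrees at s = 0
  and s = 1. Admissibility keeps \<omega> negative on the one-sided velocities up to both ends of
  each piece, which allows the quotient to be differentiated under the integral.\<close>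

lemma Ck_on_cong:
  assumes "open U" "\<And>x. x \<in> U \<Longrightarrow> f x = g x"
  shows "Ck_on k U f \<longleftrightarrow> Ck_on k U g"
  using assms(2)
proof (induction k arbitrary: f g)
  case 0
  then show ?case
    by (simp cong: continuous_on_cong)
next
  case (Suc k)
  have D: "f differentiable (at x) \<longleftrightarrow> g differentiable (at x)" if "x \<in> U" for x
    unfolding differentiable_def
    using has_derivative_transform_within_open[of f _ x UNIV U g]
      has_derivative_transform_within_open[of g _ x UNIV U f] Suc.prems assms(1) that by auto
  have "Ck_on k U (\<lambda>x. frechet_derivative f (at x) v) \<longleftrightarrow> Ck_on k U (\<lambda>x. frechet_derivative g (at x) v)"
    if "\<forall>x\<in>U. f differentiable (at x)" for v
    using Suc.prems assms(1) that
    by (intro Suc.IH) (metis frechet_derivative_transform_within_open)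
  with D show ?case
    by auto
qed

lemma Ck_on_subset: "Ck_on k U f \<Longrightarrow> V \<subseteq> U \<Longrightarrow> Ck_on k V f"
proof (induction k arbitrary: f)
  case 0
  then show ?case
    by (auto intro: continuous_on_subset)
next
  case (Suc k)
  then show ?case by (auto intro: Suc.IH)
qed

lemma Ck_on_local:
  assumes "\<And>x. x \<in> U \<Longrightarrow> \<exists>V. open V \<and> x \<in> V \<and> Ck_on k V f"
  shows "Ck_on k U f"
  using assms
proof (induction k arbitrary: f)
  case 0
  have "continuous (at x) f" if "x \<in> U" for x
    using 0[OF that] by (auto simp: continuous_on_eq_continuous_at)
  then show ?case
    by (simp add: continuous_at_imp_continuous_on)
next
  case (Suc k)
  have "f differentiable (at x)" if "x \<in> U" for x
    using Suc.prems[OF that] by auto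
  moreover have "Ck_on k U (\<lambda>x. frechet_derivative f (at x) v)" for v
  proof (rule Suc.IH)
    fix x assume "x \<in> U"
    from Suc.prems[OF this] obtain V where "open V" "x \<in> V" "Ck_on (Suc k) V f" by auto
    then show "\<exists>V. open V \<and> x \<in> V \<and> Ck_on k V (\<lambda>x. frechet_derivative f (at x) v)"
      by auto
  qed
  ultimately show ?case by simp
qed

lemma Ck_on_SucD: "Ck_on (Suc k) U f \<Longrightarrow> Ck_on k U f"
proof (induction k arbitrary: f)
  case 0
  then show ?case
    by (auto intro!: continuous_at_imp_continuous_on differentiable_imp_continuous_within)
next
  case (Suc k)
  then have "\<forall>x\<in>U. f differentiable (at x)" by simp
  moreover have "Ck_on k U (\<lambda>x. frechet_derivative f (at x) v)" for v
    using Suc.prems by (intro Suc.IH) simp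
  ultimately show ?case by simp
qed

lemma Ck_on_imp_continuous_on: "Ck_on k U f \<Longrightarrow> continuous_on U f"
  by (induction k) (simp, metis Ck_on_SucD)

lemma Ck_on_has_derivative:
  "Ck_on (Suc k) U f \<Longrightarrow> x \<in> U \<Longrightarrow> (f has_derivative frechet_derivative f (at x)) (at x)"
  by (simp flip: frechet_derivative_works)

text \<open>Uniqueness of the derivative on an open set allows an explicit formula \<open>f'\<close>
  in place of \<open>frechet_derivative\<close>; the closure properties below all go through this
  rule.\<close>

lemma Ck_on_SucI:
  assumes "open U" "\<And>x. x \<in> U \<Longrightarrow> (f has_derivative f' x) (at x)"
    and "\<And>v. Ck_on k U (\<lambda>x. f' x v)"
  shows "Ck_on (Suc k) U f"
proof -
  have "frechet_derivative f (at x) v = f' x v" if "x \<in> U" for x v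
    using assms(2)[OF that] frechet_derivative_at by metis
  then have "Ck_on k U (\<lambda>x. frechet_derivative f (at x) v)" for v
    using Ck_on_cong[OF assms(1), of "\<lambda>x. frechet_derivative f (at x) v" "\<lambda>x. f' x v" k] assms(3) by auto
  moreover have "f differentiable (at x)" if "x \<in> U" for x
    using assms(2)[OF that] differentiable_def by blast
  ultimately show ?thesis by simp
qed

lemma Ck_on_const: "open U \<Longrightarrow> Ck_on k U (\<lambda>x. c)"
proof (induction k arbitrary: c)
  case 0
  then show ?case by simp
next
  case (Suc k)
  then show ?case by (intro Ck_on_SucI[where f'="\<lambda>x v. 0"]) auto
qed

lemma Ck_on_add:
  "open U \<Longrightarrow> Ck_on k U f \<Longrightarrow> Ck_on k U g \<Longrightarrow> Ck_on k U (\<lambda>x. f x + g x)"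
proof (induction k arbitrary: f g)
  case 0
  then show ?case by (auto intro: continuous_intros)
next
  case (Suc k)
  show ?case
    by (rule Ck_on_SucI[where f'="\<lambda>x v. frechet_derivative f (at x) v + frechet_derivative g (at x) v"])
      (use Suc in \<open>auto intro!: has_derivative_add simp flip: frechet_derivative_works\<close>)
qed

lemma Ck_on_sum:
  assumes "open U" "\<And>i. i \<in> I \<Longrightarrow> Ck_on k U (f i)"
  shows "Ck_on k U (\<lambda>x. \<Sum>i\<in>I. f i x)"
  using assms(2)
  by (induction I rule: infinite_finite_induct) (auto intro: Ck_on_const Ck_on_add assms(1))

text \<open>The product rule gives a sum of two products of the same kind, so the induction closes
  once it is general in both factors; the undifferentiated factor is lowered by
  \<open>Ck_on_SucD\<close>.\<close>

lemma Ck_on_bilinear: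
  fixes prod :: "'a::euclidean_space \<Rightarrow> 'b::euclidean_space \<Rightarrow> 'c::euclidean_space"
  assumes "bounded_bilinear prod" "open U"
  shows "Ck_on k U f \<Longrightarrow> Ck_on k U g \<Longrightarrow> Ck_on k U (\<lambda>x. prod (f x) (g x))"
proof (induction k arbitrary: f g)
  case 0
  then show ?case by (auto intro: bounded_bilinear.continuous_on[OF assms(1)])
next
  case (Suc k)
  show ?case
  proof (rule Ck_on_SucI[OF assms(2), where f'="\<lambda>x v. prod (f x) (frechet_derivative g (at x) v) + prod (frechet_derivative f (at x) v) (g x)"])
    fix x assume "x \<in> U"
    then have "(f has_derivative frechet_derivative f (at x)) (at x)"
      and "(g has_derivative frechet_derivative g (at x)) (at x)"
      using Ck_on_has_derivative Suc.prems by blast+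
    then show "((\<lambda>x. prod (f x) (g x)) has_derivative (\<lambda>v. prod (f x) (frechet_derivative g (at x) v)
        + prod (frechet_derivative f (at x) v) (g x))) (at x)"
      by (rule bounded_bilinear.FDERIV[OF assms(1)])
  next
    fix v
    show "Ck_on k U (\<lambda>x. prod (f x) (frechet_derivative g (at x) v) + prod (frechet_derivative f (at x) v) (g x))"
      using Suc.prems Ck_on_SucD[OF Suc.prems(1)] Ck_on_SucD[OF Suc.prems(2)] by (intro Ck_on_add Suc.IH assms(2)) auto
  qed
qed

lemmas Ck_on_mult = Ck_on_bilinear[OF bounded_bilinear_mult]
  and Ck_on_scaleR = Ck_on_bilinear[OF bounded_bilinear_scaleR]
  and Ck_on_inner = Ck_on_bilinear[OF bounded_bilinear_inner]

text \<open>\<open>Ck_on\<close> and the tensor definitions speak only of fixed vectors. This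
  expansion is the device that carries regularity over to vectors varying with the point.\<close>

lemma linear_sum_Basis:
  fixes L :: "'a::euclidean_space \<Rightarrow> 'b::real_vector"
  assumes "linear L"
  shows "L u = (\<Sum>i\<in>Basis. (u \<bullet> i) *\<^sub>R L i)"
  by (metis (mono_tags, lifting) assms euclidean_representation linear_scale linear_sum sum.cong)

lemma Ck_on_compose:
  assumes "open U" "open V"
  shows "Ck_on k U f \<Longrightarrow> f ` U \<subseteq> V \<Longrightarrow> Ck_on k V g \<Longrightarrow> Ck_on k U (\<lambda>x. g (f x))"
proof (induction k arbitrary: g)
  case 0
  then show ?case by (auto intro: continuous_on_compose2)
next
  case (Suc k)
  \<comment> \<open>The chain rule evaluates the derivative of \<open>g\<close> in a direction that
    depends on \<open>x\<close>, which the induction hypothesis does not cover; in the basis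
    expansion only the fixed directions \<open>i\<close> remain.\<close>
  let ?f' = "\<lambda>x v. \<Sum>i\<in>Basis. (frechet_derivative f (at x) v \<bullet> i) *\<^sub>R frechet_derivative g (at (f x)) i"
  show ?case
  proof (rule Ck_on_SucI[where f'="?f'"])
    fix x assume "x \<in> U"
    then have f: "(f has_derivative frechet_derivative f (at x)) (at x)"
      and g: "(g has_derivative frechet_derivative g (at (f x))) (at (f x))"
      using Ck_on_has_derivative[OF Suc.prems(1)] Ck_on_has_derivative[OF Suc.prems(3)] Suc.prems(2) by auto
    have "(\<lambda>v. frechet_derivative g (at (f x)) (frechet_derivative f (at x) v)) = ?f' x"
      by (intro ext linear_sum_Basis has_derivative_linear[OF g])
    then show "((\<lambda>x. g (f x)) has_derivative ?f' x) (at x)"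
      using has_derivative_compose[OF f g] by simp
  next
    fix v
    have "Ck_on k U (\<lambda>x. frechet_derivative f (at x) v \<bullet> i)" for i
      using Suc.prems assms by (intro Ck_on_inner Ck_on_const) auto
    moreover have "Ck_on k U (\<lambda>x. frechet_derivative g (at (f x)) i)" for i
      using Suc.prems Ck_on_SucD[OF Suc.prems(1)] by (intro Suc.IH) auto
    ultimately show "Ck_on k U (\<lambda>x. ?f' x v)"
      using assms by (intro Ck_on_sum Ck_on_scaleR) auto
  qed (rule assms)
qed

lemma Ck_on_inverse:
  assumes "open U" "\<And>x. x \<in> U \<Longrightarrow> f x \<noteq> (0::real)"
  shows "Ck_on k U f \<Longrightarrow> Ck_on k U (\<lambda>x. inverse (f x))"
proof (induction k)
  case 0
  then show ?case using assms by (auto intro: continuous_intros)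
next
  case (Suc k)
  show ?case
  proof (rule Ck_on_SucI[where f'="\<lambda>x v. (- 1) * (inverse (f x) * frechet_derivative f (at x) v * inverse (f x))"])
    fix x assume "x \<in> U"
    then have "(f has_derivative frechet_derivative f (at x)) (at x)"
      using Ck_on_has_derivative Suc.prems by blast
    then show "((\<lambda>x. inverse (f x)) has_derivative (\<lambda>v. (- 1) * (inverse (f x) * frechet_derivative f (at x) v * inverse (f x)))) (at x)"
      using assms \<open>x \<in> U\<close> by (auto intro: derivative_eq_intros)
  next
    fix v
    show "Ck_on k U (\<lambda>x. (- 1) * (inverse (f x) * frechet_derivative f (at x) v * inverse (f x)))"
      using Suc Ck_on_SucD[OF Suc.prems] assms(1) by (intro Ck_on_mult Ck_on_const) auto
  qed (rule assms)
qed

lemma smooth_on_open_imp_Ck_on: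
  assumes "open X" "smooth_on X f"
  shows "Ck_on k X f"
proof (rule Ck_on_local)
  fix x assume "x \<in> X"
  with assms obtain U F where U: "open U" "x \<in> U" "\<forall>k. Ck_on k U F" "\<forall>y\<in>X \<inter> U. F y = f y"
    unfolding smooth_on_def by metis
  then have "Ck_on k (X \<inter> U) F" by (blast intro: Ck_on_subset)
  then have "Ck_on k (X \<inter> U) f"
    using Ck_on_cong[of "X \<inter> U" F f k] U assms(1) by auto
  with U assms(1) \<open>x \<in> X\<close> show "\<exists>V. open V \<and> x \<in> V \<and> Ck_on k V f" by blast
qed

section \<open>Partial derivatives of functions of two real variables\<close>

lemma has_vector_derivative_partials:
  fixes F :: "real \<times> real \<Rightarrow> 'b::real_normed_vector"
  assumes "(F has_derivative F') (at (r, s))"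
  shows "((\<lambda>r. F (r, s)) has_vector_derivative F' (1, 0)) (at r within I)"
    and "((\<lambda>s. F (r, s)) has_vector_derivative F' (0, 1)) (at s within J)"
proof -
  have lin: "F' (h, 0) = h *\<^sub>R F' (1, 0)" "F' (0, h) = h *\<^sub>R F' (0, 1)" for h
    using linear_scale[OF has_derivative_linear[OF assms], of h "(1, 0)"]
      linear_scale[OF has_derivative_linear[OF assms], of h "(0, 1)"]
    by (simp_all only: scaleR_Pair scaleR_zero_right real_scaleR_def mult_1_right mult_zero_right)
  have "((\<lambda>r. (r, s)) has_derivative (\<lambda>h. (h, 0))) (at r within I)"
    by (auto intro!: derivative_eq_intros)
  from has_derivative_compose[OF this assms]
  show "((\<lambda>r. F (r, s)) has_vector_derivative F' (1, 0)) (at r within I)"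
    by (simp only: has_vector_derivative_def flip: lin)
  have "((\<lambda>s. (r, s)) has_derivative (\<lambda>h. (0, h))) (at s within J)"
    by (auto intro!: derivative_eq_intros)
  from has_derivative_compose[OF this assms]
  show "((\<lambda>s. F (r, s)) has_vector_derivative F' (0, 1)) (at s within J)"
    by (simp only: has_vector_derivative_def flip: lin)
qed

text \<open>Write \<open>F (r, s) - F (r, s0 - e)\<close> as the integral of the s-derivative
  \<open>A\<close>, differentiate under the integral in r, and then differentiate in s by the
  fundamental theorem. Only continuity of the mixed derivative \<open>B\<close> is needed for
  this.\<close>

lemma mixed_partials:
  fixes F :: "real \<times> real \<Rightarrow> 'b::euclidean_space"
  assumes U: "open U" "(r0, s0) \<in> U" and F: "Ck_on 2 U F"
  shows "frechet_derivative (\<lambda>p. frechet_derivative F (at p) (0, 1)) (at (r0, s0)) (1, 0) =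
    frechet_derivative (\<lambda>p. frechet_derivative F (at p) (1, 0)) (at (r0, s0)) (0, 1)"
proof -
  define A where "A p = frechet_derivative F (at p) (0, 1)" for p
  define R where "R p = frechet_derivative F (at p) (1, 0)" for p
  define B where "B p = frechet_derivative A (at p) (1, 0)" for p
  have F': "(F has_derivative frechet_derivative F (at p)) (at p)" if "p \<in> U" for p
    using Ck_on_has_derivative[of 1 U] F that by (simp add: numeral_2_eq_2)
  have A': "(A has_derivative frechet_derivative A (at p)) (at p)" if "p \<in> U" for p
    using Ck_on_has_derivative[of 0 U A] F that by (simp add: numeral_2_eq_2 A_def[abs_def])
  have R': "(R has_derivative frechet_derivative R (at p)) (at p)" if "p \<in> U" for p
    using Ck_on_has_derivative[of 0 U R] F that by (simp add: numeral_2_eq_2 R_def[abs_def])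
  have Bc: "continuous_on U B"
    using F by (simp add: numeral_2_eq_2 B_def[abs_def] A_def[abs_def])
  have Ac: "continuous_on U A"
    using A' by (meson continuous_at_imp_continuous_on has_derivative_continuous)
  obtain e where e: "e > 0" "cbox (r0 - e, s0 - e) (r0 + e, s0 + e) \<subseteq> U"
  proof -
    obtain d where d: "d > 0" "cball (r0, s0) d \<subseteq> U"
      using U open_contains_cball by blast
    have "cbox (r0 - d/2, s0 - d/2) (r0 + d/2, s0 + d/2) \<subseteq> cball (r0, s0) d"
    proof (clarsimp simp: mem_box dist_prod_def Basis_prod_def)
      fix a b assume h: "r0 - d/2 \<le> a" "s0 - d/2 \<le> b" "a \<le> r0 + d/2" "b \<le> s0 + d/2"
      have "sqrt ((dist r0 a)\<^sup>2 + (dist s0 b)\<^sup>2) \<le> dist r0 a + dist s0 b"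
        by (rule sqrt_sum_squares_le_sum) auto
      also have "\<dots> \<le> d" using h by (auto simp: dist_real_def)
      finally show "sqrt ((dist r0 a)\<^sup>2 + (dist s0 b)\<^sup>2) \<le> d" .
    qed
    with d that[of "d/2"] show ?thesis by auto
  qed
  define I where "I = {r0 - e..r0 + e}"
  define J where "J = {s0 - e..s0 + e}"
  have IJ: "(r, s) \<in> U" if "r \<in> I" "s \<in> J" for r s
    using e(2) that by (auto simp: I_def J_def mem_box Basis_prod_def)
  have r0: "r0 \<in> I" and s0: "s0 \<in> J" using e by (auto simp: I_def J_def)
  have Fs: "((\<lambda>s. F (r, s)) has_vector_derivative A (r, s)) (at s within J)" if "r \<in> I" "s \<in> J" for r s
    using has_vector_derivative_partials(2)[OF F'[OF IJ[OF that]]] by (simp add: A_def)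
  have Fr: "((\<lambda>r. F (r, s)) has_vector_derivative R (r, s)) (at r within I)" if "r \<in> I" "s \<in> J" for r s
    using has_vector_derivative_partials(1)[OF F'[OF IJ[OF that]]] by (simp add: R_def)
  have Ar: "((\<lambda>r. A (r, s)) has_vector_derivative B (r, s)) (at r within I)" if "r \<in> I" "s \<in> J" for r s
    using has_vector_derivative_partials(1)[OF A'[OF IJ[OF that]]] by (simp add: B_def)
  have Bci: "continuous_on (I \<times> J) (\<lambda>(x, t). B (x, t))"
    using continuous_on_subset[OF Bc, of "I \<times> J"] IJ by auto
  have Aint: "(\<lambda>t. A (r, t)) integrable_on cbox a b" if "r \<in> I" "{a..b} \<subseteq> J" for r a b
    using that IJ
    by (intro integrable_continuous continuous_on_compose2[OF Ac]) (auto intro!: continuous_intros)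
  \<comment> \<open>Two r-derivatives of the same difference are compared: one by the Leibniz rule,
    the other directly as a difference of values of \<open>R\<close>.\<close>
  have key: "R (r0, s) = R (r0, s0 - e) + integral {s0 - e..s} (\<lambda>t. B (r0, t))" if s: "s \<in> J" for s
  proof -
    have sub: "cbox (s0 - e) s \<subseteq> J" and le: "s0 - e \<le> s" "s0 - e \<in> J" using s e(1) by (auto simp: J_def)
    have eq: "integral (cbox (s0 - e) s) (\<lambda>t. A (r, t)) = F (r, s) - F (r, s0 - e)" if "r \<in> I" for r
    proof -
      have "((\<lambda>s. F (r, s)) has_vector_derivative A (r, x)) (at x within {s0 - e..s})" if "x \<in> {s0 - e..s}" for x
        using has_vector_derivative_within_subset[OF Fs[OF \<open>r \<in> I\<close>], of x "{s0 - e..s}"] that sub by auto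
      from fundamental_theorem_of_calculus[OF le(1) this] show ?thesis
        by (simp add: integral_unique)
    qed
    have "((\<lambda>r. integral (cbox (s0 - e) s) (\<lambda>t. A (r, t))) has_vector_derivative
        integral (cbox (s0 - e) s) (\<lambda>t. B (r0, t))) (at r0 within I)"
    proof (rule leibniz_rule_vector_derivative[where U=I])
      show "continuous_on (I \<times> cbox (s0 - e) s) (\<lambda>(x, t). B (x, t))"
        by (rule continuous_on_subset[OF Bci]) (use sub in auto)
    qed (use Ar sub r0 Aint in \<open>auto simp: I_def\<close>)
    then have "((\<lambda>r. F (r, s) - F (r, s0 - e)) has_vector_derivative
        integral (cbox (s0 - e) s) (\<lambda>t. B (r0, t))) (at r0 within I)"
      by (rule has_vector_derivative_transform[rotated 2]) (use r0 eq in auto)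
    moreover have "((\<lambda>r. F (r, s) - F (r, s0 - e)) has_vector_derivative R (r0, s) - R (r0, s0 - e)) (at r0 within I)"
      using Fr r0 s le by (auto intro!: has_vector_derivative_diff)
    ultimately have "integral (cbox (s0 - e) s) (\<lambda>t. B (r0, t)) = R (r0, s) - R (r0, s0 - e)"
      using vector_derivative_unique_within_closed_interval[of "r0 - e" "r0 + e" r0] e(1) r0
      by (auto simp: I_def)
    then show ?thesis by simp
  qed
  have "((\<lambda>s. R (r0, s0 - e) + integral {s0 - e..s} (\<lambda>t. B (r0, t))) has_vector_derivative B (r0, s0)) (at s0 within J)"
  proof -
    have "continuous_on J (\<lambda>t. B (r0, t))"
      using IJ r0 by (intro continuous_on_compose2[OF Bc]) (auto intro!: continuous_intros)
    from integral_has_vector_derivative[OF this[unfolded J_def] s0[unfolded J_def]]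
    show ?thesis by (auto intro!: derivative_eq_intros simp: J_def)
  qed
  then have "((\<lambda>s. R (r0, s)) has_vector_derivative B (r0, s0)) (at s0 within J)"
    by (rule has_vector_derivative_transform[rotated 2]) (use s0 key in auto)
  moreover have "((\<lambda>s. R (r0, s)) has_vector_derivative frechet_derivative R (at (r0, s0)) (0, 1)) (at s0 within J)"
    by (rule has_vector_derivative_partials(2)[OF R'[OF U(2)]])
  ultimately have "B (r0, s0) = frechet_derivative R (at (r0, s0)) (0, 1)"
    using vector_derivative_unique_within_closed_interval[of "s0 - e" "s0 + e" s0] e(1) s0
    by (auto simp: J_def)
  then show ?thesis
    by (simp add: B_def A_def[abs_def] R_def[abs_def])
qed

section \<open>Charts, tangent vectors and velocities\<close>

locale manifold =
  fixes S :: "'a::topological_space set" and \<A> :: "('a, 'b::euclidean_space) chart set"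
  assumes smooth_manifold: "smooth_manifold S \<A>"
begin

lemma chart_cover: "p \<in> S \<Longrightarrow> \<exists>c\<in>\<A>. p \<in> chart_dom c"
  using smooth_manifold unfolding smooth_manifold_def by blast

lemma
  assumes "c \<in> \<A>"
  shows openin_chart_dom: "openin (top_of_set S) (chart_dom c)"
    and chart_dom_subset: "chart_dom c \<subseteq> S"
    and open_chart_img: "open (chart_img c)"
    and chart_homeomorphism: "homeomorphism (chart_dom c) (chart_img c) (coord c) (chart_inv c)"
  using smooth_manifold assms unfolding smooth_manifold_def by blast+

lemma
  assumes "c \<in> \<A>" "p \<in> chart_dom c"
  shows chart_inv_coord: "chart_inv c (coord c p) = p"
    and coord_in_chart_img: "coord c p \<in> chart_img c"
  using chart_homeomorphism[OF assms(1)] assms(2) unfolding homeomorphism_def by auto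

lemma
  assumes "c \<in> \<A>" "x \<in> chart_img c"
  shows coord_chart_inv: "coord c (chart_inv c x) = x"
    and chart_inv_in_chart_dom: "chart_inv c x \<in> chart_dom c"
  using chart_homeomorphism[OF assms(1)] assms(2) unfolding homeomorphism_def by auto

lemma
  assumes "c \<in> \<A>"
  shows continuous_on_coord: "continuous_on (chart_dom c) (coord c)"
    and continuous_on_chart_inv: "continuous_on (chart_img c) (chart_inv c)"
  using chart_homeomorphism[OF assms(1)] unfolding homeomorphism_def by auto

lemma open_chart_overlap:
  assumes "c \<in> \<A>" "c' \<in> \<A>"
  shows "open (coord c ` (chart_dom c \<inter> chart_dom c'))"
proof -
  have "coord c ` (chart_dom c \<inter> chart_dom c') = chart_img c \<inter> chart_inv c -` chart_dom c'"
    using assms by (auto simp: chart_inv_coord coord_in_chart_img chart_inv_in_chart_dom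
      intro!: image_eqI[of _ "coord c" "chart_inv c _"] simp: coord_chart_inv)
  moreover have "openin (top_of_set (chart_img c)) (chart_img c \<inter> chart_inv c -` chart_dom c')"
    using continuous_openin_preimage[OF continuous_on_chart_inv[OF assms(1)] _ openin_chart_dom[OF assms(2)]]
      chart_inv_in_chart_dom[OF assms(1)] chart_dom_subset[OF assms(1)] by blast
  ultimately show ?thesis
    using openin_open_eq[OF open_chart_img[OF assms(1)]] by auto
qed

lemma transition_has_derivative:
  assumes "c \<in> \<A>" "c' \<in> \<A>" "p \<in> chart_dom c" "p \<in> chart_dom c'"
  shows "((coord c' \<circ> chart_inv c) has_derivative
    frechet_derivative (coord c' \<circ> chart_inv c) (at (coord c p))) (at (coord c p))"
proof -
  have "smooth_on (coord c ` (chart_dom c \<inter> chart_dom c')) (coord c' \<circ> chart_inv c)"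
    using smooth_manifold assms(1,2) unfolding smooth_manifold_def by blast
  from smooth_on_open_imp_Ck_on[OF open_chart_overlap[OF assms(1,2)] this, of "Suc 0"]
  show ?thesis
    by (rule Ck_on_has_derivative) (use assms in auto)
qed

lemma chart_vec_linear:
  assumes "c \<in> \<A>" "p \<in> chart_dom c"
  shows "chart_vec \<A> c p (a *\<^sub>R u + b *\<^sub>R w) =
    (\<lambda>c'. a *\<^sub>R chart_vec \<A> c p u c' + b *\<^sub>R chart_vec \<A> c p w c')"
proof
  fix c'
  show "chart_vec \<A> c p (a *\<^sub>R u + b *\<^sub>R w) c' = a *\<^sub>R chart_vec \<A> c p u c' + b *\<^sub>R chart_vec \<A> c p w c'"
  proof (cases "c' \<in> \<A> \<and> p \<in> chart_dom c'")
    case True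
    then have "linear (frechet_derivative (coord c' \<circ> chart_inv c) (at (coord c p)))"
      using transition_has_derivative assms has_derivative_linear by blast
    with True show ?thesis
      by (simp add: chart_vec_def linear_add linear_scale)
  qed (auto simp: chart_vec_def)
qed

lemma chart_vec_self:
  assumes "c \<in> \<A>" "p \<in> chart_dom c"
  shows "chart_vec \<A> c p u c = u"
proof -
  have "((\<lambda>x. x) has_derivative (\<lambda>x. x)) (at (coord c p))"
    by auto
  then have "((coord c \<circ> chart_inv c) has_derivative (\<lambda>x. x)) (at (coord c p))"
    by (rule has_derivative_transform_within_open[OF _ open_chart_img[OF assms(1)]])
      (auto simp: coord_in_chart_img coord_chart_inv assms)
  from frechet_derivative_at[OF this, symmetric] show ?thesis
    using assms by (simp add: chart_vec_def)
qed

text \<open>The compatibility of components is the chain rule for coordinate changes: passing from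
  \<open>c\<close> to \<open>c2\<close> directly or through \<open>c1\<close> is the same map near
  \<open>coord c p\<close>.\<close>

lemma chart_vec_in_tangent_space:
  assumes "c \<in> \<A>" "p \<in> chart_dom c"
  shows "chart_vec \<A> c p u \<in> tangent_space \<A> p"
proof -
  have H: "frechet_derivative (coord c2 \<circ> chart_inv c) (at (coord c p)) u =
    frechet_derivative (coord c2 \<circ> chart_inv c1) (at (coord c1 p))
      (frechet_derivative (coord c1 \<circ> chart_inv c) (at (coord c p)) u)"
    if c12: "c1 \<in> \<A>" "c2 \<in> \<A>" "p \<in> chart_dom c1" "p \<in> chart_dom c2" for c1 c2
  proof -
    have D2: "((coord c2 \<circ> chart_inv c1) has_derivative
        frechet_derivative (coord c2 \<circ> chart_inv c1) (at (coord c1 p))) (at ((coord c1 \<circ> chart_inv c) (coord c p)))"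
      using transition_has_derivative[of c1 c2 p] c12 assms by (simp add: chart_inv_coord)
    note diff_chain_at[OF transition_has_derivative[OF assms(1) c12(1) assms(2) c12(3)] D2]
    then have "((coord c2 \<circ> chart_inv c) has_derivative
      (frechet_derivative (coord c2 \<circ> chart_inv c1) (at (coord c1 p)) \<circ>
        frechet_derivative (coord c1 \<circ> chart_inv c) (at (coord c p)))) (at (coord c p))"
      by (rule has_derivative_transform_within_open[OF _ open_chart_overlap[OF assms(1) c12(1)]])
        (use assms c12 in \<open>auto simp: chart_inv_coord\<close>)
    from frechet_derivative_at[OF this, symmetric] show ?thesis by simp
  qed
  have "chart_vec \<A> c p u c2 =
      frechet_derivative (coord c2 \<circ> chart_inv c1) (at (coord c1 p)) (chart_vec \<A> c p u c1)"
    if "c1 \<in> \<A>" "c2 \<in> \<A>" "p \<in> chart_dom c1 \<inter> chart_dom c2" for c1 c2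
    using that H[of c1 c2] by (simp add: chart_vec_def)
  moreover have "chart_vec \<A> c p u c1 = 0" if "\<not> (c1 \<in> \<A> \<and> p \<in> chart_dom c1)" for c1
    using that by (auto simp: chart_vec_def)
  ultimately show ?thesis
    unfolding tangent_space_def by blast
qed

lemma tangent_space_eq_0: "v \<in> tangent_space \<A> p \<Longrightarrow> \<not> (c \<in> \<A> \<and> p \<in> chart_dom c) \<Longrightarrow> v c = 0"
  unfolding tangent_space_def by blast

text \<open>Together with \<open>chart_vec_self\<close> this identifies the tangent space at
  \<open>p\<close> with the model space, so that tensors can be evaluated in a single chart.\<close>

lemma chart_vec_component:
  assumes "c \<in> \<A>" "p \<in> chart_dom c" "v \<in> tangent_space \<A> p"
  shows "chart_vec \<A> c p (v c) = v"
proof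
  fix c'
  have "c' \<in> \<A> \<Longrightarrow> p \<in> chart_dom c' \<Longrightarrow>
      v c' = frechet_derivative (coord c' \<circ> chart_inv c) (at (coord c p)) (v c)"
    using assms unfolding tangent_space_def by blast
  then show "chart_vec \<A> c p (v c) c' = v c'"
    using tangent_space_eq_0[OF assms(3)] by (simp add: chart_vec_def)
qed

section \<open>Curves in charts and their velocities\<close>

lemma continuous_into_chart_dom:
  fixes f :: "'c::topological_space \<Rightarrow> 'a"
  assumes "continuous_on X f" "f ` X \<subseteq> S" "c \<in> \<A>" "x \<in> X" "f x \<in> chart_dom c"
  obtains N where "open N" "x \<in> N" "\<And>y. y \<in> X \<inter> N \<Longrightarrow> f y \<in> chart_dom c"
proof -
  have "openin (top_of_set X) (X \<inter> f -` chart_dom c)"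
    using continuous_openin_preimage[OF assms(1) _ openin_chart_dom[OF assms(3)]] assms(2) by blast
  then obtain N where "open N" "X \<inter> f -` chart_dom c = X \<inter> N"
    by (auto simp: openin_open)
  with assms that show ?thesis by blast
qed

text \<open>A derivative in one chart suffices: near \<open>t\<close> every other coordinate
  expression is the first one followed by a coordinate change, whose derivative is what
  \<open>chart_vec\<close> applies to \<open>u\<close>.\<close>

lemma has_velocity_chart_vec:
  assumes \<gamma>: "continuous_on T \<gamma>" "\<gamma> ` T \<subseteq> S" and c: "c \<in> \<A>" "t \<in> T" "\<gamma> t \<in> chart_dom c"
    and D: "((coord c \<circ> \<gamma>) has_vector_derivative u) (at t within T)"
  shows "has_velocity \<A> \<gamma> (chart_vec \<A> c (\<gamma> t) u) t T"
  unfolding has_velocity_def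
proof (intro conjI ballI impI)
  show "chart_vec \<A> c (\<gamma> t) u \<in> tangent_space \<A> (\<gamma> t)"
    using chart_vec_in_tangent_space c by auto
  fix c' assume c': "c' \<in> \<A>" "\<gamma> t \<in> chart_dom c'"
  let ?D = "frechet_derivative (coord c' \<circ> chart_inv c) (at (coord c (\<gamma> t)))"
  obtain N where N: "open N" "t \<in> N" "\<And>y. y \<in> T \<inter> N \<Longrightarrow> \<gamma> y \<in> chart_dom c"
    using continuous_into_chart_dom[OF \<gamma> c] by metis
  have "((coord c' \<circ> chart_inv c) has_derivative ?D) (at ((coord c \<circ> \<gamma>) t))"
    using transition_has_derivative[OF c(1) c'(1) c(3) c'(2)] by simp
  from has_derivative_compose[OF D[unfolded has_vector_derivative_def] this]
  have "((\<lambda>x. (coord c' \<circ> chart_inv c) ((coord c \<circ> \<gamma>) x)) has_derivative (\<lambda>h. ?D (h *\<^sub>R u))) (at t within T)" .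
  moreover have "?D (h *\<^sub>R u) = h *\<^sub>R ?D u" for h
    by (rule linear_scale[OF has_derivative_linear[OF transition_has_derivative[OF c(1) c'(1) c(3) c'(2)]]])
  ultimately have "((\<lambda>x. (coord c' \<circ> chart_inv c) ((coord c \<circ> \<gamma>) x)) has_derivative (\<lambda>h. h *\<^sub>R ?D u)) (at t within T)"
    by simp
  moreover have "\<forall>\<^sub>F x in at t within T. (coord c' \<circ> chart_inv c) ((coord c \<circ> \<gamma>) x) = (coord c' \<circ> \<gamma>) x"
    unfolding eventually_at_topological
    using N c by (intro exI[of _ N]) (auto simp: chart_inv_coord)
  ultimately have "((coord c' \<circ> \<gamma>) has_derivative (\<lambda>h. h *\<^sub>R ?D u)) (at t within T)"
    by (rule has_derivative_transform_eventually) (use c in \<open>auto simp: chart_inv_coord\<close>)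
  then show "((coord c' \<circ> \<gamma>) has_vector_derivative chart_vec \<A> c (\<gamma> t) u c') (at t within T)"
    using c' by (simp add: has_vector_derivative_def chart_vec_def)
qed

lemma has_velocity_unique:
  assumes "has_velocity \<A> \<gamma> v t T" "has_velocity \<A> \<gamma> w t T" "at t within T \<noteq> bot"
  shows "v = w"
proof
  fix c
  show "v c = w c"
  proof (cases "c \<in> \<A> \<and> \<gamma> t \<in> chart_dom c")
    case True
    then show ?thesis
      using assms vector_derivative_unique_within[OF assms(3)] unfolding has_velocity_def by blast
  next
    case False
    then show ?thesis using assms tangent_space_eq_0 unfolding has_velocity_def by metis
  qed
qed

lemma has_velocity_transform:
  assumes "has_velocity \<A> \<gamma> v t T" "T' \<subseteq> T" "t \<in> T'" "\<And>x. x \<in> T' \<Longrightarrow> \<delta> x = \<gamma> x"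
  shows "has_velocity \<A> \<delta> v t T'"
  unfolding has_velocity_def
proof (intro conjI ballI impI)
  show "v \<in> tangent_space \<A> (\<delta> t)" using assms unfolding has_velocity_def by auto
  fix c assume "c \<in> \<A>" "\<delta> t \<in> chart_dom c"
  then have "((coord c \<circ> \<gamma>) has_vector_derivative v c) (at t within T')"
    using assms has_vector_derivative_within_subset unfolding has_velocity_def by metis
  then show "((coord c \<circ> \<delta>) has_vector_derivative v c) (at t within T')"
    by (rule has_vector_derivative_transform[rotated 2]) (use assms in auto)
qed

text \<open>The set \<open>T\<close> is a parameter because \<open>velocity\<close> always
  differentiates within \<open>{0..1}\<close> and so carries no information at a corner. Here
  \<open>T\<close> will be a closed smooth piece, or the parameter interval of a variation for
  derivatives in the transversal direction.\<close>

definition velocity_within :: "(real \<Rightarrow> 'a) \<Rightarrow> real set \<Rightarrow> real \<Rightarrow> ('a, 'b) tangent" where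
  "velocity_within \<gamma> T s = (\<lambda>c. if c \<in> \<A> \<and> \<gamma> s \<in> chart_dom c
     then vector_derivative (coord c \<circ> \<gamma>) (at s within T) else 0)"

lemma velocity_within_eq:
  assumes "has_velocity \<A> \<gamma> v t T" "at t within T \<noteq> bot"
  shows "velocity_within \<gamma> T t = v"
proof
  fix c
  show "velocity_within \<gamma> T t c = v c"
  proof (cases "c \<in> \<A> \<and> \<gamma> t \<in> chart_dom c")
    case True
    then show ?thesis
      using assms vector_derivative_within[OF assms(2)] unfolding has_velocity_def velocity_within_def by auto
  next
    case False
    then show ?thesis
      using assms(1) tangent_space_eq_0[of v "\<gamma> t" c] unfolding has_velocity_def velocity_within_def by presburger
  qed
qed

text \<open>The local extension \<open>F\<close> may leave the set where \<open>f\<close> is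
  controlled, so its domain is shrunk until it stays in \<open>chart_img c\<close>; tensor
  components can then be composed with \<open>F\<close> on all of the open set
  \<open>U\<close>.\<close>

lemma smooth_into_chart:
  assumes f: "smooth_into S \<A> X f" and x: "x \<in> X" "c \<in> \<A>" "f x \<in> chart_dom c"
  obtains U F where "open U" "x \<in> U" "\<And>k. Ck_on k U F" "F ` U \<subseteq> chart_img c"
    "\<And>y. y \<in> X \<inter> U \<Longrightarrow> f y \<in> chart_dom c" "\<And>y. y \<in> X \<inter> U \<Longrightarrow> F y = coord c (f y)"
proof -
  obtain N where N: "open N" "x \<in> N" "\<And>y. y \<in> X \<inter> N \<Longrightarrow> f y \<in> chart_dom c"
    using continuous_into_chart_dom[of X f c x] assms unfolding smooth_into_def by metis
  have "smooth_on {x \<in> X. f x \<in> chart_dom c} (coord c \<circ> f)"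
    using f x unfolding smooth_into_def by blast
  then obtain W F where W: "open W" "x \<in> W" "\<forall>k. Ck_on k W F"
    "\<forall>y\<in>{x \<in> X. f x \<in> chart_dom c} \<inter> W. F y = (coord c \<circ> f) y"
    using x unfolding smooth_on_def by (metis (mono_tags, lifting) mem_Collect_eq)
  have "continuous_on W F" using W(3) Ck_on_imp_continuous_on by blast
  then have "open (W \<inter> F -` chart_img c)"
    using W(1) open_chart_img[OF x(2)] by (simp add: continuous_on_open_vimage Int_commute)
  then have "open (W \<inter> F -` chart_img c \<inter> N)" using N by blast
  moreover have "x \<in> W \<inter> F -` chart_img c \<inter> N"
    using W N x coord_in_chart_img by auto
  moreover have "Ck_on k (W \<inter> F -` chart_img c \<inter> N) F" for k
    by (rule Ck_on_subset[of _ W]) (use W in auto)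
  ultimately show ?thesis
    by (rule that) (use W N in auto)
qed

end

section \<open>One-forms and bilinear forms in coordinates\<close>

text \<open>A product rule for a covector and a vector that both vary, under the sole assumption
  that the covector is differentiable on each fixed vector. Expanding in the basis reduces it to
  products of scalar functions.\<close>

lemma form_field_has_derivative:
  fixes om :: "'d::real_normed_vector \<Rightarrow> 'b::euclidean_space \<Rightarrow> real" and \<phi> :: "'c::real_normed_vector \<Rightarrow> 'd"
  assumes "open V" "\<phi> p \<in> V" and lin: "\<And>x. x \<in> V \<Longrightarrow> linear (om x)"
    and D: "\<And>u. (\<lambda>x. om x u) differentiable (at (\<phi> p))"
    and \<phi>: "(\<phi> has_derivative \<phi>') (at p)" and A: "(A has_derivative A') (at p)"
  shows "((\<lambda>q. om (\<phi> q) (A q)) has_derivative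
    (\<lambda>h. frechet_derivative (\<lambda>x. om x (A p)) (at (\<phi> p)) (\<phi>' h) + om (\<phi> p) (A' h))) (at p)"
proof -
  let ?D = "\<lambda>u. frechet_derivative (\<lambda>x. om x u) (at (\<phi> p))"
  have D: "((\<lambda>x. om x u) has_derivative ?D u) (at (\<phi> p))" for u
    by (rule iffD1[OF frechet_derivative_works D])
  have rep: "om x u = (\<Sum>i\<in>Basis. (u \<bullet> i) * om x i)" if "x \<in> V" for x u
    by (rule linear_sum_Basis[OF lin[OF that], unfolded real_scaleR_def])
  \<comment> \<open>The derivative in x inherits linearity in u from \<open>om\<close>; this is what
    allows the basis sum to be folded back into one term at \<open>A p\<close>.\<close>
  have "((\<lambda>x. \<Sum>i\<in>Basis. (u \<bullet> i) * om x i) has_derivative (\<lambda>h. \<Sum>i\<in>Basis. (u \<bullet> i) * ?D i h)) (at (\<phi> p))" for u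
    by (intro has_derivative_sum has_derivative_mult_right D)
  then have "((\<lambda>x. om x u) has_derivative (\<lambda>h. \<Sum>i\<in>Basis. (u \<bullet> i) * ?D i h)) (at (\<phi> p))" for u
    by (rule has_derivative_transform_within_open[OF _ assms(1,2)]) (rule rep[symmetric])
  then have Drep: "?D u = (\<lambda>h. \<Sum>i\<in>Basis. (u \<bullet> i) * ?D i h)" for u
    by (rule frechet_derivative_at[symmetric])
  have "((\<lambda>q. \<Sum>i\<in>Basis. (A q \<bullet> i) * om (\<phi> q) i) has_derivative
      (\<lambda>h. \<Sum>i\<in>Basis. (A p \<bullet> i) * ?D i (\<phi>' h) + (A' h \<bullet> i) * om (\<phi> p) i)) (at p)"
    by (intro has_derivative_sum has_derivative_mult has_derivative_inner_left A has_derivative_compose[OF \<phi> D])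
  moreover have "(\<Sum>i\<in>Basis. (A p \<bullet> i) * ?D i (\<phi>' h) + (A' h \<bullet> i) * om (\<phi> p) i) = ?D (A p) (\<phi>' h) + om (\<phi> p) (A' h)" for h
    unfolding sum.distrib
    by (simp only: rep[OF assms(2), of "A' h"] Drep[THEN fun_cong, of "A p" "\<phi>' h"])
  ultimately have S: "((\<lambda>q. \<Sum>i\<in>Basis. (A q \<bullet> i) * om (\<phi> q) i) has_derivative
      (\<lambda>h. ?D (A p) (\<phi>' h) + om (\<phi> p) (A' h))) (at p)"
    by simp
  have "(\<phi> \<longlongrightarrow> \<phi> p) (at p)"
    using has_derivative_continuous[OF \<phi>] by (simp add: continuous_at)
  then have "\<forall>\<^sub>F q in at p. \<phi> q \<in> V"
    using assms(1,2) topological_tendstoD by blast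
  then have "\<forall>\<^sub>F q in at p. (\<Sum>i\<in>Basis. (A q \<bullet> i) * om (\<phi> q) i) = om (\<phi> q) (A q)"
    by eventually_elim (rule rep[symmetric])
  from has_derivative_transform_eventually[OF S this _ UNIV_I] show ?thesis
    using rep[OF assms(2), of "A p"] by simp
qed

text \<open>The form lemma is used twice: with the second slot moved into the base point,
  \<open>gm\<close> becomes a covector field on \<open>V \<times> UNIV\<close>, whose own
  differentiability is an instance of the form lemma in the second slot.\<close>

lemma metric_field_has_derivative:
  fixes gm :: "'d::real_normed_vector \<Rightarrow> 'b::euclidean_space \<Rightarrow> 'b \<Rightarrow> real" and \<phi> :: "'c::real_normed_vector \<Rightarrow> 'd"
  assumes V: "open V" "\<phi> p \<in> V"
    and lin1: "\<And>x w. x \<in> V \<Longrightarrow> linear (\<lambda>u. gm x u w)"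
    and lin2: "\<And>x u. x \<in> V \<Longrightarrow> linear (gm x u)"
    and D: "\<And>x u w. x \<in> V \<Longrightarrow> (\<lambda>x. gm x u w) differentiable (at x)"
    and \<phi>: "(\<phi> has_derivative \<phi>') (at p)" and A: "(A has_derivative A') (at p)" and B: "(B has_derivative B') (at p)"
  shows "((\<lambda>q. gm (\<phi> q) (A q) (B q)) has_derivative
    (\<lambda>h. frechet_derivative (\<lambda>x. gm x (A p) (B p)) (at (\<phi> p)) (\<phi>' h) + gm (\<phi> p) (A' h) (B p)
      + gm (\<phi> p) (A p) (B' h))) (at p)"
proof -
  let ?V = "V \<times> (UNIV :: 'b set)"
  let ?om = "\<lambda>z u. gm (fst z) u (snd z)"
  let ?D = "\<lambda>u z h. frechet_derivative (\<lambda>x. gm x u (snd z)) (at (fst z)) (fst h) + gm (fst z) u (snd h)"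
  have om: "((\<lambda>z. ?om z u) has_derivative ?D u z) (at z)" if "z \<in> ?V" for z u
    by (rule form_field_has_derivative[OF V(1), where om="\<lambda>x w. gm x u w"])
      (use that lin2 D in \<open>auto intro: derivative_intros\<close>)
  have "((\<lambda>q. ?om (\<phi> q, B q) (A q)) has_derivative
    (\<lambda>h. frechet_derivative (\<lambda>z. ?om z (A p)) (at (\<phi> p, B p)) (\<phi>' h, B' h) + ?om (\<phi> p, B p) (A' h))) (at p)"
    by (rule form_field_has_derivative[where V="?V" and om="?om"])
      (use V lin1 om in \<open>auto intro!: open_Times differentiableI has_derivative_Pair \<phi> A B\<close>)
  moreover have "frechet_derivative (\<lambda>z. ?om z (A p)) (at (\<phi> p, B p)) = ?D (A p) (\<phi> p, B p)"
    using frechet_derivative_at[OF om, of "(\<phi> p, B p)" "A p"] V by simp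
  ultimately show ?thesis
    by (simp add: algebra_simps)
qed

lemma Ck_on_form_field:
  fixes om :: "'d::euclidean_space \<Rightarrow> 'b::euclidean_space \<Rightarrow> real"
  assumes "open U" "open V" "\<phi> ` U \<subseteq> V" "\<And>x. x \<in> V \<Longrightarrow> linear (om x)"
    and "\<And>u. Ck_on k V (\<lambda>x. om x u)" "Ck_on k U \<phi>" "Ck_on k U A"
  shows "Ck_on k U (\<lambda>q. om (\<phi> q) (A q))"
proof -
  have "Ck_on k U (\<lambda>q. om (\<phi> q) i)" for i
    by (rule Ck_on_compose[OF assms(1,2,6,3,5)])
  then have "Ck_on k U (\<lambda>q. \<Sum>i\<in>Basis. (A q \<bullet> i) * om (\<phi> q) i)"
    by (intro Ck_on_sum Ck_on_mult Ck_on_inner Ck_on_const assms(1,7))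
  moreover have "(\<Sum>i\<in>Basis. (A q \<bullet> i) * om (\<phi> q) i) = om (\<phi> q) (A q)" if "q \<in> U" for q
    using linear_sum_Basis[of "om (\<phi> q)" "A q"] assms(3,4) that by auto
  ultimately show ?thesis
    by (rule iffD1[OF Ck_on_cong[OF assms(1)], rotated])
qed

lemma Ck_on_metric_field:
  fixes gm :: "'d::euclidean_space \<Rightarrow> 'b::euclidean_space \<Rightarrow> 'b \<Rightarrow> real"
  assumes "open U" "open V" "\<phi> ` U \<subseteq> V" "\<And>x w. x \<in> V \<Longrightarrow> linear (\<lambda>u. gm x u w)"
    and "\<And>x u. x \<in> V \<Longrightarrow> linear (gm x u)"
    and "\<And>u w. Ck_on k V (\<lambda>x. gm x u w)" "Ck_on k U \<phi>" "Ck_on k U A" "Ck_on k U B"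
  shows "Ck_on k U (\<lambda>q. gm (\<phi> q) (A q) (B q))"
proof -
  have "Ck_on k U (\<lambda>q. gm (\<phi> q) (A q) i)" for i
    by (rule Ck_on_form_field[where om="\<lambda>x u. gm x u i", OF assms(1-4,6-8)])
  then have "Ck_on k U (\<lambda>q. \<Sum>i\<in>Basis. (B q \<bullet> i) * gm (\<phi> q) (A q) i)"
    by (intro Ck_on_sum Ck_on_mult Ck_on_inner Ck_on_const assms(1,9))
  moreover have "(\<Sum>i\<in>Basis. (B q \<bullet> i) * gm (\<phi> q) (A q) i) = gm (\<phi> q) (A q) (B q)" if "q \<in> U" for q
    using linear_sum_Basis[of "gm (\<phi> q) (A q)" "B q"] assms(3,5) that by auto
  ultimately show ?thesis
    by (rule iffD1[OF Ck_on_cong[OF assms(1)], rotated])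
qed

section \<open>First variation along an orbit\<close>

text \<open>The difference of the two sides is d\<omega> evaluated on the two partial derivatives of
  \<open>F\<close>. At \<open>p\<close> one of them is a multiple of the field, and Cartan's formula
  i_Y d\<omega> = L_Y \<omega> - d(\<omega>(Y)) makes the value vanish. Tangency to the field is
  required at the single point \<open>p\<close> only.\<close>

lemma first_variation_form:
  fixes om :: "'b::euclidean_space \<Rightarrow> 'b \<Rightarrow> real" and F :: "real \<times> real \<Rightarrow> 'b"
  defines "A \<equiv> \<lambda>q. frechet_derivative F (at q) (0, 1)"
    and "R \<equiv> \<lambda>q. frechet_derivative F (at q) (1, 0)"
  assumes V: "open V" and lin: "\<And>x. x \<in> V \<Longrightarrow> linear (om x)"
    and D: "\<And>x u. x \<in> V \<Longrightarrow> (\<lambda>x. om x u) differentiable (at x)"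
    and y: "\<And>x. x \<in> V \<Longrightarrow> y differentiable (at x)"
    and const: "\<And>x. x \<in> V \<Longrightarrow> om x (y x) = k"
    and lie: "\<And>x u. x \<in> V \<Longrightarrow>
      frechet_derivative (\<lambda>x. om x u) (at x) (y x) + om x (frechet_derivative y (at x) u) = 0"
    and U: "open U" "p \<in> U" and F: "Ck_on 2 U F" "F p \<in> V"
    and A: "A p = T *\<^sub>R y (F p)"
  shows "frechet_derivative (\<lambda>q. om (F q) (A q)) (at p) (1, 0) =
    frechet_derivative (\<lambda>q. om (F q) (R q)) (at p) (0, 1)"
proof -
  have F': "(F has_derivative frechet_derivative F (at p)) (at p)"
    using Ck_on_has_derivative[of 1 U F p] F U by (simp add: numeral_2_eq_2)
  have A': "(A has_derivative frechet_derivative A (at p)) (at p)"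
    using Ck_on_has_derivative[of 0 U A p] F U by (simp add: numeral_2_eq_2 A_def)
  have R': "(R has_derivative frechet_derivative R (at p)) (at p)"
    using Ck_on_has_derivative[of 0 U R p] F U by (simp add: numeral_2_eq_2 R_def)
  have y': "(y has_derivative frechet_derivative y (at (F p))) (at (F p))"
    by (rule iffD1[OF frechet_derivative_works y[OF F(2)]])
  note om = linear_scale[OF lin[OF F(2)]]
  \<comment> \<open>This differentiates the constant \<open>om x (T *\<^sub>R y x) = T * k\<close>;
    in the direction \<open>R p\<close> it expresses the derivative of \<open>om\<close> through
    that of \<open>y\<close>.\<close>
  have "((\<lambda>x. om x (T *\<^sub>R y x)) has_derivative
      (\<lambda>h. frechet_derivative (\<lambda>x. om x (T *\<^sub>R y (F p))) (at (F p)) h + om (F p) (T *\<^sub>R frechet_derivative y (at (F p)) h))) (at (F p))"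
    by (rule form_field_has_derivative[where V=V and \<phi>="\<lambda>x. x"])
      (use V F lin D in \<open>auto intro!: has_derivative_scaleR_right y'\<close>)
  from has_derivative_unique[OF this, of "\<lambda>h. 0"] have "(\<lambda>h. frechet_derivative (\<lambda>x. om x (T *\<^sub>R y (F p))) (at (F p)) h
      + om (F p) (T *\<^sub>R frechet_derivative y (at (F p)) h)) = (\<lambda>h. 0)"
    using has_derivative_transform_within_open[OF has_derivative_const[of "T * k"] V F(2), of "\<lambda>x. om x (T *\<^sub>R y x)"]
    by (simp add: linear_scale[OF lin] const)
  from fun_cong[OF this, of "R p"] have c: "frechet_derivative (\<lambda>x. om x (T *\<^sub>R y (F p))) (at (F p)) (R p) + T * om (F p) (frechet_derivative y (at (F p)) (R p)) = 0"
    by (simp add: om)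
  have "frechet_derivative (\<lambda>q. om (F q) (A q)) (at p) (1, 0) =
      frechet_derivative (\<lambda>x. om x (A p)) (at (F p)) (R p) + om (F p) (frechet_derivative A (at p) (1, 0))"
    by (subst frechet_derivative_at[OF form_field_has_derivative[where V=V and \<phi>=F, OF V F(2) lin D F' A'], symmetric])
      (use F(2) in \<open>auto simp: R_def\<close>)
  moreover have "frechet_derivative (\<lambda>q. om (F q) (R q)) (at p) (0, 1) =
      frechet_derivative (\<lambda>x. om x (R p)) (at (F p)) (A p) + om (F p) (frechet_derivative R (at p) (0, 1))"
    by (subst frechet_derivative_at[OF form_field_has_derivative[where V=V and \<phi>=F, OF V F(2) lin D F' R'], symmetric])
      (use F(2) in \<open>auto simp: A_def\<close>)
  moreover have "frechet_derivative (\<lambda>x. om x (R p)) (at (F p)) (A p) = T * frechet_derivative (\<lambda>x. om x (R p)) (at (F p)) (y (F p))"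
    using linear_scale[OF linear_frechet_derivative[OF D[OF F(2)]]] A by simp
  moreover have "frechet_derivative A (at p) (1, 0) = frechet_derivative R (at p) (0, 1)"
    using mixed_partials[of U "fst p" "snd p" F] U F by (simp add: A_def R_def)
  moreover have "frechet_derivative (\<lambda>x. om x (R p)) (at (F p)) (y (F p)) = - om (F p) (frechet_derivative y (at (F p)) (R p))"
    using lie[OF F(2), of "R p"] by simp
  ultimately show ?thesis
    using c A by simp
qed

text \<open>In terms of the Levi-Civita connection, with \<xi> = \<open>R p\<close>, the left side
  is 2 T g(\<nabla>_s \<xi>, Y), and the derivative on the right is g(\<nabla>_s \<xi>, Y) + T
  g(\<xi>, \<nabla>_Y Y). The last term vanishes because \<nabla>_Y Y is minus half the gradient of
  g(Y,Y), which is zero at the point.\<close>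

lemma first_variation_metric:
  fixes gm :: "'b::euclidean_space \<Rightarrow> 'b \<Rightarrow> 'b \<Rightarrow> real" and F :: "real \<times> real \<Rightarrow> 'b"
  defines "A \<equiv> \<lambda>q. frechet_derivative F (at q) (0, 1)"
    and "R \<equiv> \<lambda>q. frechet_derivative F (at q) (1, 0)"
  assumes V: "open V" and lin1: "\<And>x w. x \<in> V \<Longrightarrow> linear (\<lambda>u. gm x u w)"
    and lin2: "\<And>x u. x \<in> V \<Longrightarrow> linear (gm x u)"
    and sym: "\<And>x u w. x \<in> V \<Longrightarrow> gm x u w = gm x w u"
    and D: "\<And>x u w. x \<in> V \<Longrightarrow> (\<lambda>x. gm x u w) differentiable (at x)"
    and y: "\<And>x. x \<in> V \<Longrightarrow> y differentiable (at x)"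
    and crit: "((\<lambda>x. gm x (y x) (y x)) has_derivative (\<lambda>h. 0)) (at (F p))"
    and killing: "\<And>x u w. x \<in> V \<Longrightarrow> frechet_derivative (\<lambda>x. gm x u w) (at x) (y x)
      + gm x (frechet_derivative y (at x) u) w + gm x u (frechet_derivative y (at x) w) = 0"
    and U: "open U" "p \<in> U" and F: "Ck_on 2 U F" "F p \<in> V"
    and A: "A p = T *\<^sub>R y (F p)"
  shows "frechet_derivative (\<lambda>q. gm (F q) (A q) (A q)) (at p) (1, 0) =
    2 * T * frechet_derivative (\<lambda>q. gm (F q) (R q) (y (F q))) (at p) (0, 1)"
proof -
  have F': "(F has_derivative frechet_derivative F (at p)) (at p)"
    using Ck_on_has_derivative[of 1 U F p] F U by (simp add: numeral_2_eq_2)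
  have A': "(A has_derivative frechet_derivative A (at p)) (at p)"
    using Ck_on_has_derivative[of 0 U A p] F U by (simp add: numeral_2_eq_2 A_def)
  have R': "(R has_derivative frechet_derivative R (at p)) (at p)"
    using Ck_on_has_derivative[of 0 U R p] F U by (simp add: numeral_2_eq_2 R_def)
  let ?x = "F p" let ?y' = "frechet_derivative y (at (F p))"
  have y': "(y has_derivative ?y') (at ?x)"
    by (rule iffD1[OF frechet_derivative_works y[OF F(2)]])
  note g1 = linear_scale[OF lin1[OF F(2)], simplified] and g2 = linear_scale[OF lin2[OF F(2)], simplified]
  have "((\<lambda>x. gm x (T *\<^sub>R y x) (T *\<^sub>R y x)) has_derivative
      (\<lambda>h. frechet_derivative (\<lambda>x. gm x (T *\<^sub>R y ?x) (T *\<^sub>R y ?x)) (at ?x) h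
        + gm ?x (T *\<^sub>R ?y' h) (T *\<^sub>R y ?x) + gm ?x (T *\<^sub>R y ?x) (T *\<^sub>R ?y' h))) (at ?x)"
    by (rule metric_field_has_derivative[where V=V and \<phi>="\<lambda>x. x"])
      (use V F lin1 lin2 D in \<open>auto intro!: has_derivative_scaleR_right y'\<close>)
  moreover have "((\<lambda>x. gm x (T *\<^sub>R y x) (T *\<^sub>R y x)) has_derivative (\<lambda>h. 0)) (at ?x)"
  proof (rule has_derivative_transform_within_open[OF _ V F(2)])
    show "((\<lambda>x. T * T * gm x (y x) (y x)) has_derivative (\<lambda>h. 0)) (at ?x)"
      using has_derivative_mult_right[OF crit, of "T * T"] by simp
  qed (simp add: linear_scale[OF lin1] linear_scale[OF lin2])
  ultimately have c: "frechet_derivative (\<lambda>x. gm x (T *\<^sub>R y ?x) (T *\<^sub>R y ?x)) (at ?x) (R p)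
      + gm ?x (T *\<^sub>R ?y' (R p)) (T *\<^sub>R y ?x) + gm ?x (T *\<^sub>R y ?x) (T *\<^sub>R ?y' (R p)) = 0"
    by (rule fun_cong[OF has_derivative_unique])
  \<comment> \<open>Both sides reduce to these two quantities: \<open>crit\<close> brings the left
    one to this form and \<open>killing\<close> the right one, where the terms with the derivative
    of \<open>y\<close> in the direction \<open>y\<close> cancel.\<close>
  let ?M = "gm ?x (frechet_derivative A (at p) (1, 0)) (y ?x)"
  let ?P = "gm ?x (?y' (R p)) (y ?x)"
  have "frechet_derivative (\<lambda>q. gm (F q) (A q) (A q)) (at p) (1, 0) =
      frechet_derivative (\<lambda>x. gm x (A p) (A p)) (at ?x) (R p)
      + gm ?x (frechet_derivative A (at p) (1, 0)) (A p) + gm ?x (A p) (frechet_derivative A (at p) (1, 0))"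
    by (subst frechet_derivative_at[OF metric_field_has_derivative[where V=V and \<phi>=F, OF V F(2) lin1 lin2 D F' A' A'], symmetric])
      (use F(2) in \<open>auto simp: R_def\<close>)
  also have "\<dots> = 2 * T * ?M - 2 * T * T * ?P"
    using c sym[OF F(2), of "y ?x"] by (simp add: A g1 g2 algebra_simps)
  finally have lhs: "frechet_derivative (\<lambda>q. gm (F q) (A q) (A q)) (at p) (1, 0) = 2 * T * ?M - 2 * T * T * ?P" .
  have "frechet_derivative (\<lambda>q. gm (F q) (R q) (y (F q))) (at p) (0, 1) =
      frechet_derivative (\<lambda>x. gm x (R p) (y ?x)) (at ?x) (A p)
      + gm ?x (frechet_derivative R (at p) (0, 1)) (y ?x) + gm ?x (R p) (?y' (A p))"
    by (subst frechet_derivative_at[OF metric_field_has_derivative[where V=V and \<phi>=F, OF V F(2) lin1 lin2 D F' R'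
            has_derivative_compose[OF F' y']], symmetric])
      (use F(2) in \<open>auto simp: A_def\<close>)
  also have "frechet_derivative (\<lambda>x. gm x (R p) (y ?x)) (at ?x) (A p) = T * frechet_derivative (\<lambda>x. gm x (R p) (y ?x)) (at ?x) (y ?x)"
    using linear_scale[OF linear_frechet_derivative[OF D[OF F(2)]]] A by simp
  also have "frechet_derivative (\<lambda>x. gm x (R p) (y ?x)) (at ?x) (y ?x) = - ?P - gm ?x (R p) (?y' (y ?x))"
    using killing[OF F(2), of "R p" "y ?x"] by simp
  also have "?y' (A p) = T *\<^sub>R ?y' (y ?x)"
    using linear_scale[OF has_derivative_linear[OF y']] A by simp
  also have "frechet_derivative R (at p) (0, 1) = frechet_derivative A (at p) (1, 0)"
    using mixed_partials[of U "fst p" "snd p" F] U F by (simp add: A_def R_def)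
  finally have rhs: "frechet_derivative (\<lambda>q. gm (F q) (R q) (y (F q))) (at p) (0, 1) = ?M - T * ?P"
    by (simp add: g2 algebra_simps)
  show ?thesis
    unfolding lhs rhs by (simp add: algebra_simps)
qed

text \<open>The energy density agrees with a C^1 function only locally on the strip, with a chart
  and an extension that change from point to point. The Leibniz rule needs a derivative in r that is
  continuous on the whole strip, which is assembled here from the local pieces.\<close>

lemma leibniz_rule_locally_C1:
  fixes \<Phi> :: "real \<Rightarrow> real \<Rightarrow> real"
  assumes I: "open I" "convex I" "r0 \<in> I"
    and loc: "\<And>r s. r \<in> I \<Longrightarrow> s \<in> {a..b} \<Longrightarrow> \<exists>U \<Psi>. open U \<and> (r, s) \<in> U \<and> Ck_on 1 U \<Psi> \<and>
      (\<forall>r' s'. (r', s') \<in> U \<longrightarrow> r' \<in> I \<longrightarrow> s' \<in> {a..b} \<longrightarrow> \<Phi> r' s' = \<Psi> (r', s'))"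
    and D: "\<And>s. s \<in> {a..b} \<Longrightarrow> ((\<lambda>r. \<Phi> r s) has_real_derivative D s) (at r0)"
  shows "r \<in> I \<Longrightarrow> \<Phi> r integrable_on {a..b}"
    and "((\<lambda>r. integral {a..b} (\<Phi> r)) has_real_derivative integral {a..b} D) (at r0)"
proof -
  \<comment> \<open>Because \<open>I\<close> is open, the r-derivative of any local representative
    is the true one, even when \<open>s\<close> is an endpoint of \<open>{a..b}\<close>.\<close>
  have key: "((\<lambda>r. \<Phi> r s) has_real_derivative frechet_derivative \<Psi> (at (r, s)) (1, 0)) (at r)"
    if \<Psi>: "open U" "Ck_on 1 U \<Psi>" "(r, s) \<in> U" "r \<in> I" "s \<in> {a..b}"
      "\<forall>r' s'. (r', s') \<in> U \<longrightarrow> r' \<in> I \<longrightarrow> s' \<in> {a..b} \<longrightarrow> \<Phi> r' s' = \<Psi> (r', s')" for U \<Psi> r s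
  proof -
    have "((\<lambda>r. \<Psi> (r, s)) has_real_derivative frechet_derivative \<Psi> (at (r, s)) (1, 0)) (at r)"
      using has_vector_derivative_partials(1)[OF Ck_on_has_derivative[OF \<Psi>(2)[unfolded One_nat_def] \<Psi>(3)]]
      by (simp add: has_real_derivative_iff_has_vector_derivative)
    moreover have "open (I \<inter> (\<lambda>r. (r, s)) -` U)"
      using I(1) \<Psi>(1) by (intro open_Int open_vimage continuous_intros) auto
    ultimately show ?thesis
      by (rule has_field_derivative_transform_within_open) (use \<Psi> in auto)
  qed
  have \<Phi>c: "continuous_on (I \<times> {a..b}) (\<lambda>(r, s). \<Phi> r s)"
    and Dc: "continuous_on (I \<times> {a..b}) (\<lambda>(r, s). deriv (\<lambda>r. \<Phi> r s) r)"
  proof -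
    have "continuous (at (r, s) within I \<times> {a..b}) (\<lambda>(r, s). \<Phi> r s) \<and>
        continuous (at (r, s) within I \<times> {a..b}) (\<lambda>(r, s). deriv (\<lambda>r. \<Phi> r s) r)"
      if rs: "r \<in> I" "s \<in> {a..b}" for r s
    proof -
      obtain U \<Psi> where U: "open U" "(r, s) \<in> U" "Ck_on 1 U \<Psi>"
        "\<forall>r' s'. (r', s') \<in> U \<longrightarrow> r' \<in> I \<longrightarrow> s' \<in> {a..b} \<longrightarrow> \<Phi> r' s' = \<Psi> (r', s')"
        using loc[OF rs] by blast
      have ev: "\<forall>\<^sub>F p in at (r, s) within I \<times> {a..b}. p \<in> U \<inter> I \<times> {a..b}"
        unfolding eventually_at_topological using U by auto
      have "continuous_on U \<Psi>" "continuous_on U (\<lambda>p. frechet_derivative \<Psi> (at p) (1, 0))"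
        using Ck_on_imp_continuous_on[OF U(3)] U(3) by (auto simp del: split_paired_All)
      then have "continuous (at (r, s) within I \<times> {a..b}) \<Psi>"
        "continuous (at (r, s) within I \<times> {a..b}) (\<lambda>p. frechet_derivative \<Psi> (at p) (1, 0))"
        using U by (auto simp: continuous_on_eq_continuous_at intro: continuous_at_imp_continuous_at_within)
      then have "(\<Psi> \<longlongrightarrow> \<Phi> r s) (at (r, s) within I \<times> {a..b})"
        "((\<lambda>p. frechet_derivative \<Psi> (at p) (1, 0)) \<longlongrightarrow> deriv (\<lambda>r. \<Phi> r s) r) (at (r, s) within I \<times> {a..b})"
        using U rs DERIV_imp_deriv[OF key[OF U(1,3,2) rs U(4)]] by (auto simp: continuous_within)
      moreover have "\<forall>\<^sub>F p in at (r, s) within I \<times> {a..b}. \<Psi> p = \<Phi> (fst p) (snd p)"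
        using ev by eventually_elim (auto simp: U(4))
      moreover have "\<forall>\<^sub>F p in at (r, s) within I \<times> {a..b}.
          frechet_derivative \<Psi> (at p) (1, 0) = deriv (\<lambda>r. \<Phi> r (snd p)) (fst p)"
        using ev by eventually_elim (auto intro!: DERIV_imp_deriv[OF key[OF U(1,3) _ _ _ U(4)], symmetric])
      ultimately show ?thesis
        unfolding continuous_within split_beta fst_conv snd_conv
        by (blast intro: Lim_transform_eventually)
    qed
    then show "continuous_on (I \<times> {a..b}) (\<lambda>(r, s). \<Phi> r s)"
      "continuous_on (I \<times> {a..b}) (\<lambda>(r, s). deriv (\<lambda>r. \<Phi> r s) r)"
      by (auto simp: continuous_on_eq_continuous_within)
  qed
  have int: "\<Phi> r integrable_on cbox a b" if "r \<in> I" for r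
  proof -
    have "continuous_on {a..b} (\<lambda>s. (\<lambda>(r, s). \<Phi> r s) (r, s))"
      by (rule continuous_on_compose2[OF \<Phi>c]) (use that in \<open>auto intro!: continuous_intros\<close>)
    then show ?thesis by (auto intro: integrable_continuous_interval)
  qed
  then show "r \<in> I \<Longrightarrow> \<Phi> r integrable_on {a..b}" by simp
  have "((\<lambda>r. integral (cbox a b) (\<Phi> r)) has_real_derivative integral (cbox a b) (\<lambda>s. deriv (\<lambda>r. \<Phi> r s) r0)) (at r0 within I)"
  proof (rule leibniz_rule_field_derivative[OF _ int _ I(3,2)])
    show "continuous_on (I \<times> cbox a b) (\<lambda>(r, s). deriv (\<lambda>r. \<Phi> r s) r)" using Dc by simp
    fix r s assume rs: "r \<in> I" "s \<in> cbox a b"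
    then obtain U \<Psi> where U: "open U" "(r, s) \<in> U" "Ck_on 1 U \<Psi>"
      "\<forall>r' s'. (r', s') \<in> U \<longrightarrow> r' \<in> I \<longrightarrow> s' \<in> {a..b} \<longrightarrow> \<Phi> r' s' = \<Psi> (r', s')"
      using loc[of r s] by auto
    have "((\<lambda>r. \<Phi> r s) has_real_derivative frechet_derivative \<Psi> (at (r, s)) (1, 0)) (at r)"
      by (rule key[OF U(1,3,2)]) (use U rs in auto)
    then show "((\<lambda>r. \<Phi> r s) has_real_derivative deriv (\<lambda>r. \<Phi> r s) r) (at r within I)"
      using DERIV_imp_deriv has_field_derivative_at_within by metis
  qed
  moreover have "integral (cbox a b) (\<lambda>s. deriv (\<lambda>r. \<Phi> r s) r0) = integral {a..b} D"
    using DERIV_imp_deriv[OF D] by (auto intro: integral_cong)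
  ultimately show "((\<lambda>r. integral {a..b} (\<Phi> r)) has_real_derivative integral {a..b} D) (at r0)"
    using at_within_open[OF I(3,1)] by simp
qed

section \<open>Killing fields and Kropina metrics\<close>

locale kropina_killing = manifold S \<A>
  for S :: "'a::topological_space set" and \<A> :: "('a, 'b::euclidean_space) chart set" +
  fixes g :: "'a \<Rightarrow> ('a, 'b) tangent \<Rightarrow> ('a, 'b) tangent \<Rightarrow> real"
    and \<omega> :: "'a \<Rightarrow> ('a, 'b) tangent \<Rightarrow> real"
    and Y :: "'a \<Rightarrow> ('a, 'b) tangent"
    and k :: real
  assumes riemannian_metric: "riemannian_metric S \<A> g"
    and killing_field: "killing_field S \<A> g Y"
    and smooth_one_form: "smooth_one_form S \<A> \<omega>"
    and k: "k < 0" "p \<in> S \<Longrightarrow> \<omega> p (Y p) = k"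
    and lie_form_zero: "lie_form_zero \<A> Y \<omega>"
begin

section \<open>Coordinate expressions of the given fields\<close>

lemma Y_tangent: "p \<in> S \<Longrightarrow> Y p \<in> tangent_space \<A> p"
  using killing_field unfolding killing_field_def smooth_vector_field_def by blast

lemma vec_rep_coord: "c \<in> \<A> \<Longrightarrow> p \<in> chart_dom c \<Longrightarrow> vec_rep c Y (coord c p) = Y p c"
  by (simp add: vec_rep_def chart_inv_coord)

lemma form_eq_rep:
  assumes "c \<in> \<A>" "p \<in> chart_dom c" "v \<in> tangent_space \<A> p"
  shows "\<omega> p v = form_rep \<A> c \<omega> (coord c p) (v c)"
  using assms by (simp add: form_rep_def chart_inv_coord chart_vec_component)

lemma metric_eq_rep:
  assumes "c \<in> \<A>" "p \<in> chart_dom c" "v \<in> tangent_space \<A> p" "w \<in> tangent_space \<A> p"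
  shows "g p v w = metric_rep \<A> c g (coord c p) (v c) (w c)"
  using assms by (simp add: metric_rep_def chart_inv_coord chart_vec_component)

lemma linear_form_rep:
  assumes "c \<in> \<A>" "x \<in> chart_img c"
  shows "linear (form_rep \<A> c \<omega> x)"
proof -
  let ?p = "chart_inv c x"
  have p: "?p \<in> chart_dom c" using chart_inv_in_chart_dom assms by blast
  then have "linear_on_tangent \<A> ?p (\<omega> ?p)"
    using smooth_one_form chart_dom_subset[OF assms(1)] unfolding smooth_one_form_def by blast
  then have "\<omega> ?p (chart_vec \<A> c ?p (a *\<^sub>R u + b *\<^sub>R w)) =
      a * \<omega> ?p (chart_vec \<A> c ?p u) + b * \<omega> ?p (chart_vec \<A> c ?p w)" for a b u w
    using chart_vec_in_tangent_space[OF assms(1) p] unfolding chart_vec_linear[OF assms(1) p] linear_on_tangent_def by blast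
  from this[of 1 _ 1] this[of _ _ 0 0] show ?thesis
    by (intro linearI) (simp_all add: form_rep_def)
qed

lemma linear_metric_rep2:
  assumes "c \<in> \<A>" "x \<in> chart_img c"
  shows "linear (metric_rep \<A> c g x u)"
proof -
  let ?p = "chart_inv c x"
  have p: "?p \<in> chart_dom c" using chart_inv_in_chart_dom assms by blast
  note tan = chart_vec_in_tangent_space[OF assms(1) p]
  have "linear_on_tangent \<A> ?p (g ?p (chart_vec \<A> c ?p u))"
    using riemannian_metric chart_dom_subset[OF assms(1)] p tan unfolding riemannian_metric_def by blast
  then have "g ?p (chart_vec \<A> c ?p u) (chart_vec \<A> c ?p (a *\<^sub>R v + b *\<^sub>R w)) =
      a * g ?p (chart_vec \<A> c ?p u) (chart_vec \<A> c ?p v) + b * g ?p (chart_vec \<A> c ?p u) (chart_vec \<A> c ?p w)" for a b v w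
    using tan unfolding chart_vec_linear[OF assms(1) p] linear_on_tangent_def by blast
  from this[of 1 _ 1] this[of _ _ 0 0] show ?thesis
    by (intro linearI) (simp_all add: metric_rep_def)
qed

lemma metric_rep_sym:
  assumes "c \<in> \<A>" "x \<in> chart_img c"
  shows "metric_rep \<A> c g x u w = metric_rep \<A> c g x w u"
  using riemannian_metric chart_inv_in_chart_dom[OF assms] chart_dom_subset[OF assms(1)]
    chart_vec_in_tangent_space[OF assms(1) chart_inv_in_chart_dom[OF assms]]
  unfolding riemannian_metric_def metric_rep_def by blast

text \<open>\<open>riemannian_metric\<close> states linearity in the second slot; symmetry transfers
  it to the first.\<close>

lemma linear_metric_rep1:
  assumes "c \<in> \<A>" "x \<in> chart_img c"
  shows "linear (\<lambda>u. metric_rep \<A> c g x u w)"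
  using linear_metric_rep2[OF assms, of w] metric_rep_sym[OF assms, of _ w] by simp

lemma
  assumes "c \<in> \<A>"
  shows Ck_on_form_rep: "Ck_on j (chart_img c) (\<lambda>x. form_rep \<A> c \<omega> x u)"
    and Ck_on_metric_rep: "Ck_on j (chart_img c) (\<lambda>x. metric_rep \<A> c g x u w)"
    and Ck_on_vec_rep: "Ck_on j (chart_img c) (vec_rep c Y)"
proof -
  note sm = smooth_on_open_imp_Ck_on[OF open_chart_img[OF assms]]
  show "Ck_on j (chart_img c) (\<lambda>x. form_rep \<A> c \<omega> x u)"
    using smooth_one_form assms unfolding smooth_one_form_def by (intro sm) blast
  show "Ck_on j (chart_img c) (\<lambda>x. metric_rep \<A> c g x u w)"
    using riemannian_metric assms unfolding riemannian_metric_def by (intro sm) blast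
  show "Ck_on j (chart_img c) (vec_rep c Y)"
    using killing_field assms unfolding killing_field_def smooth_vector_field_def by (intro sm) blast
qed

lemma
  assumes "c \<in> \<A>" "x \<in> chart_img c"
  shows differentiable_form_rep: "(\<lambda>x. form_rep \<A> c \<omega> x u) differentiable (at x)"
    and differentiable_metric_rep: "(\<lambda>x. metric_rep \<A> c g x u w) differentiable (at x)"
    and differentiable_vec_rep: "vec_rep c Y differentiable (at x)"
  using Ck_on_form_rep[OF assms(1), of "Suc 0"] Ck_on_metric_rep[OF assms(1), of "Suc 0"]
    Ck_on_vec_rep[OF assms(1), of "Suc 0"] assms(2)
  by (simp_all only: Ck_on.simps)

lemma form_rep_vec_rep:
  assumes "c \<in> \<A>" "x \<in> chart_img c"
  shows "form_rep \<A> c \<omega> x (vec_rep c Y x) = k"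
proof -
  have p: "chart_inv c x \<in> chart_dom c" "chart_inv c x \<in> S"
    using chart_inv_in_chart_dom[OF assms] chart_dom_subset[OF assms(1)] by auto
  show ?thesis
    using form_eq_rep[OF assms(1) p(1) Y_tangent[OF p(2)]] k(2)[OF p(2)]
    by (simp add: coord_chart_inv assms vec_rep_def)
qed

lemma
  assumes "c \<in> \<A>" "x \<in> chart_img c"
  shows lie_form: "frechet_derivative (\<lambda>x. form_rep \<A> c \<omega> x u) (at x) (vec_rep c Y x)
      + form_rep \<A> c \<omega> x (frechet_derivative (vec_rep c Y) (at x) u) = 0"
    and lie_metric: "frechet_derivative (\<lambda>x. metric_rep \<A> c g x u w) (at x) (vec_rep c Y x)
      + metric_rep \<A> c g x (frechet_derivative (vec_rep c Y) (at x) u) w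
      + metric_rep \<A> c g x u (frechet_derivative (vec_rep c Y) (at x) w) = 0"
  using lie_form_zero killing_field assms
  unfolding lie_form_zero_def lie_form_rep_def killing_field_def lie_metric_rep_def by blast+

text \<open>This is the function f of the overview. Since \<omega>(Y) = k, the Kropina length of Y
  is \<open>- f / (2 * k)\<close>, so f measures how fast an orbit is traversed.\<close>

definition energy_density :: "'a \<Rightarrow> real" where
  "energy_density p = g p (Y p) (Y p)"

lemma energy_density_rep:
  assumes "c \<in> \<A>" "x \<in> chart_img c"
  shows "energy_density (chart_inv c x) = metric_rep \<A> c g x (vec_rep c Y x) (vec_rep c Y x)"
proof -
  have p: "chart_inv c x \<in> chart_dom c" "chart_inv c x \<in> S"
    using chart_inv_in_chart_dom[OF assms] chart_dom_subset[OF assms(1)] by auto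
  show ?thesis
    using metric_eq_rep[OF assms(1) p(1) Y_tangent Y_tangent] p
    by (simp add: energy_density_def coord_chart_inv assms vec_rep_def)
qed

text \<open>By the product rule, the derivative in the direction of the field is literally the left
  side of the Killing equation with both arguments equal to the field.\<close>

lemma energy_density_has_derivative:
  assumes c: "c \<in> \<A>" and x: "x \<in> chart_img c"
  obtains D where "((\<lambda>x. energy_density (chart_inv c x)) has_derivative D) (at x)" "D (vec_rep c Y x) = 0"
proof -
  let ?gm = "metric_rep \<A> c g" and ?y = "vec_rep c Y"
  let ?D = "\<lambda>h. frechet_derivative (\<lambda>z. ?gm z (?y x) (?y x)) (at x) h
    + ?gm x (frechet_derivative ?y (at x) h) (?y x) + ?gm x (?y x) (frechet_derivative ?y (at x) h)"
  have y: "(?y has_derivative frechet_derivative ?y (at x)) (at x)"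
    by (rule iffD1[OF frechet_derivative_works differentiable_vec_rep[OF assms]])
  have "((\<lambda>z. ?gm z (?y z) (?y z)) has_derivative ?D) (at x)"
    by (rule metric_field_has_derivative[where V="chart_img c" and \<phi>="\<lambda>z. z", OF open_chart_img[OF c] x
          linear_metric_rep1[OF c] linear_metric_rep2[OF c] differentiable_metric_rep[OF c] has_derivative_ident y y])
  then have "((\<lambda>x. energy_density (chart_inv c x)) has_derivative ?D) (at x)"
    by (rule has_derivative_transform_within_open[OF _ open_chart_img[OF c] x]) (simp add: energy_density_rep c)
  then show ?thesis
    by (rule that) (rule lie_metric[OF assms])
qed

text \<open>Requiring the condition in every chart around \<open>p\<close> avoids a change-of-chart
  argument when a variation later picks its own chart.\<close>

definition critical :: "'a \<Rightarrow> bool" where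
  "critical p \<longleftrightarrow> (\<forall>c\<in>\<A>. p \<in> chart_dom c \<longrightarrow>
    ((\<lambda>x. energy_density (chart_inv c x)) has_derivative (\<lambda>h. 0)) (at (coord c p)))"

text \<open>Without boundary, chart images are open, so a global extremum on \<open>S\<close> is an
  interior extremum of each coordinate expression.\<close>

lemma extremal_imp_critical:
  assumes "(\<forall>q\<in>S. energy_density q \<le> energy_density p) \<or> (\<forall>q\<in>S. energy_density p \<le> energy_density q)"
  shows "critical p"
  unfolding critical_def
proof (intro ballI impI)
  fix c assume c: "c \<in> \<A>" "p \<in> chart_dom c"
  obtain D where D: "((\<lambda>x. energy_density (chart_inv c x)) has_derivative D) (at (coord c p))"
    using energy_density_has_derivative[OF c(1) coord_in_chart_img[OF c]] .
  have "D = (\<lambda>h. 0)"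
    by (rule differential_zero_maxmin[OF coord_in_chart_img[OF c] open_chart_img[OF c(1)] D])
      (use assms c chart_inv_in_chart_dom[OF c(1)] chart_dom_subset[OF c(1)] in \<open>auto simp: chart_inv_coord\<close>)
  with D show "((\<lambda>x. energy_density (chart_inv c x)) has_derivative (\<lambda>h. 0)) (at (coord c p))" by simp
qed

lemma continuous_on_energy_density: "continuous_on S energy_density"
  unfolding continuous_openin_preimage_eq
proof (intro allI impI)
  fix B :: "real set" assume B: "open B"
  have "openin (top_of_set S) (chart_dom c \<inter> energy_density -` B)" if c: "c \<in> \<A>" for c
  proof -
    have "isCont (\<lambda>x. energy_density (chart_inv c x)) x" if "x \<in> chart_img c" for x
      using energy_density_has_derivative[OF c that] has_derivative_continuous by metis
    then have "continuous_on (chart_img c) (\<lambda>x. energy_density (chart_inv c x))"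
      by (simp add: continuous_at_imp_continuous_on)
    from continuous_on_compose2[OF this continuous_on_coord[OF c]]
    have "continuous_on (chart_dom c) (\<lambda>q. energy_density (chart_inv c (coord c q)))"
      by (auto simp: chart_img_def)
    then have "continuous_on (chart_dom c) energy_density"
      by (rule continuous_on_eq) (simp add: chart_inv_coord c)
    then show ?thesis
      using B openin_trans[OF _ openin_chart_dom[OF c]] unfolding continuous_openin_preimage_eq by blast
  qed
  then have "openin (top_of_set S) (\<Union>c\<in>\<A>. chart_dom c \<inter> energy_density -` B)"
    by (intro openin_Union) auto
  moreover have "(\<Union>c\<in>\<A>. chart_dom c \<inter> energy_density -` B) = S \<inter> energy_density -` B"
    by (auto dest: chart_cover subsetD[OF chart_dom_subset])
  ultimately show "openin (top_of_set S) (S \<inter> energy_density -` B)" by simp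
qed

text \<open>The derivative along the orbit is the derivative of the coordinate expression in the
  direction of \<open>Y\<close>, which the Killing equation makes zero.\<close>

lemma energy_density_orbit:
  assumes \<gamma>: "complete_integral_curve S \<A> Y \<gamma>"
  shows "energy_density (\<gamma> t) = energy_density (\<gamma> 0)"
proof -
  have "((\<lambda>t. energy_density (\<gamma> t)) has_real_derivative 0) (at t)" for t
  proof -
    have \<gamma>': "range \<gamma> \<subseteq> S" "continuous_on UNIV \<gamma>" "has_velocity \<A> \<gamma> (Y (\<gamma> t)) t UNIV"
      using \<gamma> unfolding complete_integral_curve_def by auto
    obtain c where c: "c \<in> \<A>" "\<gamma> t \<in> chart_dom c" using chart_cover \<gamma>' by blast
    obtain N where N: "open N" "t \<in> N" "\<And>s. s \<in> UNIV \<inter> N \<Longrightarrow> \<gamma> s \<in> chart_dom c"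
      using continuous_into_chart_dom[of UNIV \<gamma> c t] \<gamma>' c by auto
    obtain D where D: "((\<lambda>x. energy_density (chart_inv c x)) has_derivative D) (at (coord c (\<gamma> t)))"
      "D (vec_rep c Y (coord c (\<gamma> t))) = 0"
      using energy_density_has_derivative[OF c(1) coord_in_chart_img[OF c]] .
    have "((coord c \<circ> \<gamma>) has_vector_derivative Y (\<gamma> t) c) (at t)"
      using \<gamma>'(3) c unfolding has_velocity_def by auto
    from has_derivative_compose[OF this[unfolded has_vector_derivative_def]] D(1)
    have "((\<lambda>s. energy_density (chart_inv c ((coord c \<circ> \<gamma>) s))) has_derivative (\<lambda>h. D (h *\<^sub>R Y (\<gamma> t) c))) (at t)"
      by simp
    moreover have "D (h *\<^sub>R Y (\<gamma> t) c) = 0" for h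
      using D(2) linear_scale[OF has_derivative_linear[OF D(1)]] vec_rep_coord[OF c] by simp
    ultimately have "((\<lambda>s. energy_density (chart_inv c ((coord c \<circ> \<gamma>) s))) has_real_derivative 0) (at t)"
      by (simp add: has_field_derivative_def lambda_zero)
    then show ?thesis
      by (rule has_field_derivative_transform_within_open[OF _ N(1,2)]) (use N(3) in \<open>auto simp: chart_inv_coord c\<close>)
  qed
  then show ?thesis
    using DERIV_isconst_all by blast
qed

end

section \<open>First variation of the energy\<close>

lemma at_within_Icc_neq_bot:
  fixes a b s :: real
  shows "a < b \<Longrightarrow> s \<in> {a..b} \<Longrightarrow> at s within {a..b} \<noteq> bot"
  by (auto simp: trivial_limit_within intro!: islimpt_closure_open[where s="{a<..<b}"])

lemma has_vector_derivative_transform_eventually: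
  assumes "(f has_vector_derivative D) (at s within T)" "open N" "s \<in> N" "s \<in> T"
    and "\<And>x. x \<in> T \<inter> N \<Longrightarrow> f x = h x"
  shows "(h has_vector_derivative D) (at s within T)"
proof -
  have "\<forall>\<^sub>F x in at s within T. f x = h x"
    unfolding eventually_at_topological using assms by blast
  from has_derivative_transform_eventually[OF assms(1)[unfolded has_vector_derivative_def] this _ assms(4)]
  show ?thesis using assms by (simp add: has_vector_derivative_def)
qed

lemma periodic_ext_eq:
  assumes "\<gamma> 0 = \<gamma> 1" "t \<in> {0..1}"
  shows "periodic_ext \<gamma> t = \<gamma> t"
proof (cases "t = 1")
  case True
  then show ?thesis using assms by (simp add: periodic_ext_def)
next
  case False
  then have "frac t = t" using assms(2) by (simp add: frac_eq)
  then show ?thesis by (simp add: periodic_ext_def)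
qed

text \<open>True even where no derivative exists: the two derivative relations coincide, hence so do
  the values chosen by \<open>vector_derivative\<close>.\<close>

lemma (in manifold) velocity_within_cong:
  assumes "\<And>x. x \<in> T \<Longrightarrow> \<gamma> x = \<delta> x" "s \<in> T"
  shows "velocity_within \<gamma> T s = velocity_within \<delta> T s"
proof -
  have "((coord c \<circ> \<gamma>) has_vector_derivative v) (at s within T) \<longleftrightarrow>
      ((coord c \<circ> \<delta>) has_vector_derivative v) (at s within T)" for c :: "('a, 'b) chart" and v
    using assms has_vector_derivative_transform[of s T "coord c \<circ> \<delta>" "coord c \<circ> \<gamma>" v]
      has_vector_derivative_transform[of s T "coord c \<circ> \<gamma>" "coord c \<circ> \<delta>" v] by auto
  with assms show ?thesis
    unfolding velocity_within_def vector_derivative_def by (intro ext) simp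
qed

text \<open>This keeps the denominator of \<open>kropina\<close> away from zero on each closed
  smooth piece, endpoints included. At \<open>s < b\<close> the right derivative of the loop
  decides, at \<open>s = b\<close> the left one; each agrees with the velocity within the piece by
  uniqueness.\<close>

lemma (in manifold) admissible_loop_velocity:
  assumes \<gamma>: "\<gamma> \<in> admissible_loops S \<A> \<omega>" and ab: "0 \<le> a" "a < b" "b \<le> 1" and s: "s \<in> {a..b}"
    and v: "has_velocity \<A> \<gamma> v s {a..b}"
  shows "\<omega> (\<gamma> s) v < 0"
proof -
  have loop: "\<gamma> 0 = \<gamma> 1" and s01: "s \<in> {0..1}"
    using \<gamma> ab s by (auto simp: admissible_loops_def)
  have "\<exists>w\<in>kropina_domain \<A> \<omega> (\<gamma> s). \<exists>T\<subseteq>{a..b}. s \<in> T \<and> at s within T \<noteq> bot \<and> has_velocity \<A> (periodic_ext \<gamma>) w s T"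
  proof (cases "s < b")
    case True
    obtain w where w: "w \<in> kropina_domain \<A> \<omega> (\<gamma> s)" "has_velocity \<A> (periodic_ext \<gamma>) w s {s..}"
      using \<gamma> s01 unfolding admissible_loops_def by blast
    have "has_velocity \<A> (periodic_ext \<gamma>) w s {s..b}"
      by (rule has_velocity_transform[OF w(2)]) (use True in auto)
    with w(1) True s show ?thesis
      by (intro bexI[of _ w] exI[of _ "{s..b}"]) (use at_within_Icc_neq_bot[of s b s] in auto)
  next
    case False
    then have sb: "s = b" using s by simp
    obtain w where w: "w \<in> kropina_domain \<A> \<omega> (\<gamma> s)" "has_velocity \<A> (periodic_ext \<gamma>) w s {..s}"
      using \<gamma> s01 unfolding admissible_loops_def by blast
    have "has_velocity \<A> (periodic_ext \<gamma>) w s {a..b}"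
      by (rule has_velocity_transform[OF w(2)]) (use sb ab in auto)
    with w(1) s ab show ?thesis
      by (intro bexI[of _ w] exI[of _ "{a..b}"]) (use at_within_Icc_neq_bot[of a b s] in auto)
  qed
  then obtain w T where w: "w \<in> kropina_domain \<A> \<omega> (\<gamma> s)" "T \<subseteq> {a..b}" "s \<in> T"
    "at s within T \<noteq> bot" "has_velocity \<A> (periodic_ext \<gamma>) w s T" by blast
  have "has_velocity \<A> \<gamma> w s T"
    by (rule has_velocity_transform[OF w(5)]) (use w ab in \<open>auto intro!: periodic_ext_eq[symmetric] loop\<close>)
  moreover have "has_velocity \<A> \<gamma> v s T"
    by (rule has_velocity_transform[OF v]) (use w in auto)
  ultimately have "v = w" using has_velocity_unique w(4) by blast
  with w(1) show ?thesis by (simp add: kropina_domain_def)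
qed

context kropina_killing
begin

lemma kropina_eq_rep:
  assumes "c \<in> \<A>" "p \<in> chart_dom c"
  shows "kropina g \<omega> p (chart_vec \<A> c p u) =
    - (metric_rep \<A> c g (coord c p) u u / (2 * form_rep \<A> c \<omega> (coord c p) u))"
  using assms by (simp add: kropina_def metric_rep_def form_rep_def chart_inv_coord)

lemma scaled_orbit_has_velocity:
  assumes \<gamma>: "complete_integral_curve S \<A> Y \<gamma>" and s: "s \<in> X"
  shows "has_velocity \<A> (\<lambda>s. \<gamma> (T * s)) (\<lambda>c. T *\<^sub>R Y (\<gamma> (T * s)) c) s X"
proof -
  have \<gamma>': "range \<gamma> \<subseteq> S" "continuous_on UNIV \<gamma>" "has_velocity \<A> \<gamma> (Y (\<gamma> (T * s))) (T * s) UNIV"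
    using \<gamma> unfolding complete_integral_curve_def by auto
  obtain c where c: "c \<in> \<A>" "\<gamma> (T * s) \<in> chart_dom c" using chart_cover \<gamma>' by blast
  have "((\<lambda>s. T * s) has_vector_derivative T) (at s)"
    by (auto intro!: derivative_eq_intros)
  moreover have "((coord c \<circ> \<gamma>) has_vector_derivative Y (\<gamma> (T * s)) c) (at (T * s))"
    using \<gamma>'(3) c unfolding has_velocity_def by auto
  ultimately have "((coord c \<circ> (\<lambda>s. \<gamma> (T * s))) has_vector_derivative T *\<^sub>R Y (\<gamma> (T * s)) c) (at s)"
    using vector_diff_chain_at[of "\<lambda>s. T * s" T s "coord c \<circ> \<gamma>"] by (simp add: comp_def)
  then have "has_velocity \<A> (\<lambda>s. \<gamma> (T * s)) (chart_vec \<A> c (\<gamma> (T * s)) (T *\<^sub>R Y (\<gamma> (T * s)) c)) s UNIV"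
    using \<gamma>' c by (intro has_velocity_chart_vec) (auto intro!: continuous_on_compose2[OF \<gamma>'(2)] continuous_intros)
  moreover have "chart_vec \<A> c (\<gamma> (T * s)) (T *\<^sub>R Y (\<gamma> (T * s)) c) = (\<lambda>c. T *\<^sub>R Y (\<gamma> (T * s)) c)"
    using chart_vec_linear[OF c, of T _ 0 0] chart_vec_component[OF c Y_tangent] \<gamma>'(1)
    by (simp add: range_subsetD)
  ultimately show ?thesis
    using has_velocity_transform[of "\<lambda>s. \<gamma> (T * s)" _ s UNIV X] s by simp
qed

end

locale orbit_variation = kropina_killing S \<A> g \<omega> Y k
  for S :: "'a::topological_space set" and \<A> :: "('a, 'b::euclidean_space) chart set"
    and g \<omega> Y k +
  fixes \<gamma> :: "real \<Rightarrow> 'a" and T \<epsilon> :: real and H :: "real \<Rightarrow> real \<Rightarrow> 'a"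
  assumes orbit: "complete_integral_curve S \<A> Y \<gamma>"
    and critical_orbit: "critical (\<gamma> t)"
    and T: "T > 0" and \<epsilon>: "\<epsilon> > 0"
    and variation: "admissible_variation S \<A> \<omega> (\<lambda>s. \<gamma> (T * s)) \<epsilon> H"
begin

definition I :: "real set" where "I = {-\<epsilon><..<\<epsilon>}"

lemma I: "open I" "convex I" "0 \<in> I"
  using \<epsilon> by (auto simp: I_def)

lemma H_0: "s \<in> {0..1} \<Longrightarrow> H 0 s = \<gamma> (T * s)"
  and H_admissible: "r \<in> I \<Longrightarrow> H r \<in> admissible_loops S \<A> \<omega>"
  using variation unfolding admissible_variation_def I_def by auto

text \<open>The field \<xi> is defined for each \<open>s\<close> separately and without reference to
  a subdivision, so it has one value at a corner, shared by both adjacent pieces.\<close>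

definition variation_field :: "real \<Rightarrow> ('a, 'b) tangent" where
  "variation_field s = velocity_within (\<lambda>r. H r s) I 0"

text \<open>The Kropina length of the velocity \<open>T\<close> times \<open>Y\<close>, simplified
  by \<omega>(Y) = k; it is constant along the orbit.\<close>

definition kropina_speed :: real where
  "kropina_speed = - (T * energy_density (\<gamma> 0) / (2 * k))"

text \<open>The fibre derivative 2 K dK of \<open>K^2\<close> at the orbit velocity, applied to
  \<xi>. The bracket is dK(\<xi>); it contains no \<open>T\<close> because K is homogeneous of
  degree one and dK therefore of degree zero.\<close>

definition boundary_term :: "real \<Rightarrow> real" where
  "boundary_term s = 2 * kropina_speed * (- (g (H 0 s) (variation_field s) (Y (H 0 s)) / k)
    + energy_density (\<gamma> 0) * \<omega> (H 0 s) (variation_field s) / (2 * k\<^sup>2))"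

text \<open>Each member of the variation is a loop, so r-curves at s = 0 and s = 1 coincide,
  together with their derivatives.\<close>

lemma boundary_term_1: "boundary_term 1 = boundary_term 0"
proof -
  have H: "H r 1 = H r 0" if "r \<in> I" for r
    using H_admissible[OF that] by (simp add: admissible_loops_def)
  then have "variation_field 1 = variation_field 0"
    unfolding variation_field_def by (intro velocity_within_cong I)
  with H[OF I(3)] show ?thesis by (simp add: boundary_term_def)
qed

text \<open>One chart and one smooth extension serve a whole neighbourhood in the strip, and the
  velocities in both parameters are the partial derivatives of that extension. Those along the loop
  are taken within \<open>{a..b}\<close>, hence one-sided at its ends.\<close>

lemma variation_chart:
  assumes ab: "a < b" and H: "smooth_into S \<A> (I \<times> {a..b}) (\<lambda>(r, s). H r s)"
    and rs0: "r0 \<in> I" "s0 \<in> {a..b}"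
  obtains c U F where "c \<in> \<A>" "open U" "(r0, s0) \<in> U" "\<And>j. Ck_on j U F" "F ` U \<subseteq> chart_img c"
    "\<And>r s. (r, s) \<in> U \<Longrightarrow> r \<in> I \<Longrightarrow> s \<in> {a..b} \<Longrightarrow> H r s \<in> chart_dom c"
    "\<And>r s. (r, s) \<in> U \<Longrightarrow> r \<in> I \<Longrightarrow> s \<in> {a..b} \<Longrightarrow> F (r, s) = coord c (H r s)"
    "\<And>r s. (r, s) \<in> U \<Longrightarrow> r \<in> I \<Longrightarrow> s \<in> {a..b} \<Longrightarrow>
      has_velocity \<A> (H r) (chart_vec \<A> c (H r s) (frechet_derivative F (at (r, s)) (0, 1))) s {a..b}"
    "\<And>r s. (r, s) \<in> U \<Longrightarrow> r \<in> I \<Longrightarrow> s \<in> {a..b} \<Longrightarrow>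
      has_velocity \<A> (\<lambda>r. H r s) (chart_vec \<A> c (H r s) (frechet_derivative F (at (r, s)) (1, 0))) r I"
proof -
  have HS: "H r s \<in> S" if "r \<in> I" "s \<in> {a..b}" for r s
    using H that unfolding smooth_into_def by fast
  have Hc: "continuous_on (I \<times> {a..b}) (\<lambda>(r, s). H r s)"
    using H by (simp add: smooth_into_def)
  have Hc1: "continuous_on {a..b} (H r)" if "r \<in> I" for r
    using continuous_on_compose2[OF Hc continuous_on_Pair[OF continuous_on_const[of _ r] continuous_on_id]] that by auto
  have Hc2: "continuous_on I (\<lambda>r. H r s)" if "s \<in> {a..b}" for s
    using continuous_on_compose2[OF Hc continuous_on_Pair[OF continuous_on_id[of I] continuous_on_const[of I s]]] that by (simp add: image_subset_iff)
  obtain c where c: "c \<in> \<A>" "H r0 s0 \<in> chart_dom c" using chart_cover[OF HS[OF rs0]] by blast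
  obtain U F where U: "open U" "(r0, s0) \<in> U" "\<And>j. Ck_on j U F" "F ` U \<subseteq> chart_img c"
    "\<And>q. q \<in> (I \<times> {a..b}) \<inter> U \<Longrightarrow> (case q of (r, s) \<Rightarrow> H r s) \<in> chart_dom c"
    "\<And>q. q \<in> (I \<times> {a..b}) \<inter> U \<Longrightarrow> F q = coord c (case q of (r, s) \<Rightarrow> H r s)"
    by (rule smooth_into_chart[OF H, of "(r0, s0)" c]) (use c rs0 in auto)
  have dom: "H r s \<in> chart_dom c" and F: "F (r, s) = coord c (H r s)"
    if "(r, s) \<in> U" "r \<in> I" "s \<in> {a..b}" for r s
    using U(5,6)[of "(r, s)"] that by auto
  have F': "(F has_derivative frechet_derivative F (at q)) (at q)" if "q \<in> U" for q
    using Ck_on_has_derivative[OF U(3) that] .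
  show ?thesis
  proof (rule that[OF c(1) U(1,2,3,4) dom F])
    fix r s assume rs: "(r, s) \<in> U" "r \<in> I" "s \<in> {a..b}"
    show "has_velocity \<A> (H r) (chart_vec \<A> c (H r s) (frechet_derivative F (at (r, s)) (0, 1))) s {a..b}"
    proof (rule has_velocity_chart_vec)
      have "open ((\<lambda>s. (r, s)) -` U)"
        using U(1) by (intro open_vimage continuous_intros) auto
      then show "((coord c \<circ> H r) has_vector_derivative frechet_derivative F (at (r, s)) (0, 1)) (at s within {a..b})"
        by (rule has_vector_derivative_transform_eventually[OF has_vector_derivative_partials(2)[OF F'[OF rs(1)]]])
          (use rs F in auto)
    qed (use rs HS Hc1 c dom in auto)
    show "has_velocity \<A> (\<lambda>r. H r s) (chart_vec \<A> c (H r s) (frechet_derivative F (at (r, s)) (1, 0))) r I"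
    proof (rule has_velocity_chart_vec)
      have "open ((\<lambda>r. (r, s)) -` U)"
        using U(1) by (intro open_vimage continuous_intros) auto
      then show "((coord c \<circ> (\<lambda>r. H r s)) has_vector_derivative frechet_derivative F (at (r, s)) (1, 0)) (at r within I)"
        by (rule has_vector_derivative_transform_eventually[OF has_vector_derivative_partials(1)[OF F'[OF rs(1)]]])
          (use rs F in auto)
    qed (use rs HS Hc2 c dom in auto)
  qed
qed

text \<open>The core identity: the same number \<open>d\<close> is the r-derivative of the density
  and the s-derivative of the boundary term. Everything is moved into one chart and read off from
  the two first-variation lemmas.\<close>

lemma pointwise_first_variation:
  assumes ab: "0 \<le> a" "a < b" "b \<le> 1" and H: "smooth_into S \<A> (I \<times> {a..b}) (\<lambda>(r, s). H r s)"
    and s: "s \<in> {a..b}"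
  obtains d where
    "((\<lambda>r. (kropina g \<omega> (H r s) (velocity_within (H r) {a..b} s))\<^sup>2) has_real_derivative d) (at 0)"
    "(boundary_term has_vector_derivative d) (at s within {a..b})"
proof -
  obtain c U F where c: "c \<in> \<A>" and U: "open U" "(0, s) \<in> U" "\<And>j. Ck_on j U F" "F ` U \<subseteq> chart_img c"
    and dom: "\<And>r s. (r, s) \<in> U \<Longrightarrow> r \<in> I \<Longrightarrow> s \<in> {a..b} \<Longrightarrow> H r s \<in> chart_dom c"
    and F: "\<And>r s. (r, s) \<in> U \<Longrightarrow> r \<in> I \<Longrightarrow> s \<in> {a..b} \<Longrightarrow> F (r, s) = coord c (H r s)"
    and Hs: "\<And>r s. (r, s) \<in> U \<Longrightarrow> r \<in> I \<Longrightarrow> s \<in> {a..b} \<Longrightarrow>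
      has_velocity \<A> (H r) (chart_vec \<A> c (H r s) (frechet_derivative F (at (r, s)) (0, 1))) s {a..b}"
    and Hr: "\<And>r s. (r, s) \<in> U \<Longrightarrow> r \<in> I \<Longrightarrow> s \<in> {a..b} \<Longrightarrow>
      has_velocity \<A> (\<lambda>r. H r s) (chart_vec \<A> c (H r s) (frechet_derivative F (at (r, s)) (1, 0))) r I"
    by (rule variation_chart[OF ab(2) H I(3) s]) (rule that; assumption)
  define A where "A q = frechet_derivative F (at q) (0, 1)" for q
  define R where "R q = frechet_derivative F (at q) (1, 0)" for q
  define gm where "gm = metric_rep \<A> c g"
  define om where "om = form_rep \<A> c \<omega>"
  define y where "y = vec_rep c Y"
  define G where "G q = gm (F q) (A q) (A q)" for q
  define W where "W q = om (F q) (A q)" for q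
  define M where "M q = gm (F q) (R q) (y (F q))" for q
  define N where "N q = om (F q) (R q)" for q
  let ?V = "chart_img c" let ?p = "(0 :: real, s)" let ?f = "energy_density (\<gamma> 0)"
  define M' where "M' = frechet_derivative M (at ?p) (0, 1)"
  define N' where "N' = frechet_derivative N (at ?p) (0, 1)"
  have V: "open ?V" using open_chart_img[OF c] .
  have x: "F ?p \<in> ?V" using U by blast
  have AR: "Ck_on 1 U A" "Ck_on 1 U R"
    using U(3)[of 2] by (simp_all add: numeral_2_eq_2 A_def[abs_def] R_def[abs_def])
  note lin = linear_form_rep[OF c, folded om_def] linear_metric_rep1[OF c, folded gm_def] linear_metric_rep2[OF c, folded gm_def]
  note Cks = Ck_on_form_rep[OF c, folded om_def] Ck_on_metric_rep[OF c, folded gm_def]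
  have Cy: "Ck_on 1 U (\<lambda>q. y (F q))"
    by (rule Ck_on_compose[OF U(1) V U(3,4)]) (simp only: y_def Ck_on_vec_rep[OF c])
  have "Ck_on 1 U G" "Ck_on 1 U M"
    unfolding G_def[abs_def] M_def[abs_def]
    by (rule Ck_on_metric_field[OF U(1) V U(4) lin(2,3) Cks(2) U(3)]; use AR Cy in blast)+
  moreover have "Ck_on 1 U W" "Ck_on 1 U N"
    unfolding W_def[abs_def] N_def[abs_def]
    by (rule Ck_on_form_field[OF U(1) V U(4) lin(1) Cks(1) U(3)]; use AR in blast)+
  ultimately have D: "(G has_derivative frechet_derivative G (at ?p)) (at ?p)"
    "(M has_derivative frechet_derivative M (at ?p)) (at ?p)"
    "(W has_derivative frechet_derivative W (at ?p)) (at ?p)"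
    "(N has_derivative frechet_derivative N (at ?p)) (at ?p)"
    unfolding One_nat_def by (blast intro: Ck_on_has_derivative U(2))+
  have s01: "s \<in> {0..1}" using s ab by auto
  have H0: "H 0 s = \<gamma> (T * s)" using H_0[OF s01] .
  have p: "\<gamma> (T * s) \<in> chart_dom c" "F ?p = coord c (\<gamma> (T * s))"
    using dom[OF U(2) I(3) s] F[OF U(2) I(3) s] H0 by auto
  \<comment> \<open>Only at r = 0 is the curve an orbit, run at speed factor \<open>T\<close>; this
    is the tangency hypothesis of the first-variation lemmas.\<close>
  have A0: "A ?p = T *\<^sub>R y (F ?p)"
  proof -
    have "has_velocity \<A> (H 0) (\<lambda>c. T *\<^sub>R Y (\<gamma> (T * s)) c) s {a..b}"
      by (rule has_velocity_transform[OF scaled_orbit_has_velocity[OF orbit s] order_refl s])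
        (use ab in \<open>auto intro!: H_0\<close>)
    from has_velocity_unique[OF Hs[OF U(2) I(3) s] this at_within_Icc_neq_bot[OF ab(2) s]]
    have "chart_vec \<A> c (\<gamma> (T * s)) (A ?p) c = T *\<^sub>R Y (\<gamma> (T * s)) c"
      by (simp add: A_def H0)
    then show ?thesis
      using chart_vec_self[OF c p(1)] vec_rep_coord[OF c p(1)] p(2) by (simp add: y_def)
  qed
  have f0: "gm (F ?p) (y (F ?p)) (y (F ?p)) = ?f"
    using energy_density_rep[OF c x] energy_density_orbit[OF orbit, of "T * s"] p
    by (simp add: chart_inv_coord[OF c] gm_def y_def)
  have crit: "((\<lambda>x. gm x (y x) (y x)) has_derivative (\<lambda>h. 0)) (at (F ?p))"
  proof (rule has_derivative_transform_within_open[OF _ V x])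
    show "((\<lambda>x. energy_density (chart_inv c x)) has_derivative (\<lambda>h. 0)) (at (F ?p))"
      using critical_orbit[of "T * s"] c p unfolding critical_def by simp
  qed (simp add: energy_density_rep[OF c] gm_def y_def)
  have W': "frechet_derivative W (at ?p) (1, 0) = N'"
    unfolding W_def[abs_def] N_def[abs_def] N'_def A_def R_def om_def
    by (rule first_variation_form[OF V linear_form_rep[OF c] differentiable_form_rep[OF c] differentiable_vec_rep[OF c]
          form_rep_vec_rep[OF c] lie_form[OF c] U(1,2,3) x A0[unfolded A_def y_def]])
  have G': "frechet_derivative G (at ?p) (1, 0) = 2 * T * M'"
    unfolding G_def[abs_def] M_def[abs_def] M'_def A_def R_def gm_def y_def
    by (rule first_variation_metric[OF V linear_metric_rep1[OF c] linear_metric_rep2[OF c] metric_rep_sym[OF c]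
          differentiable_metric_rep[OF c] differentiable_vec_rep[OF c]
          crit[unfolded gm_def y_def] lie_metric[OF c] U(1,2,3) x A0[unfolded A_def y_def]])
  have W0: "W ?p = T * k"
    using linear_scale[OF lin(1)[OF x]] form_rep_vec_rep[OF c x] by (simp add: W_def A0 om_def y_def)
  have G0: "G ?p = T\<^sup>2 * ?f"
    using linear_scale[OF lin(2)[OF x]] linear_scale[OF lin(3)[OF x]] f0 by (simp add: G_def A0 power2_eq_square)
  \<comment> \<open>The quotient rule for \<open>(G / (2 * W))\<^sup>2\<close> at r = 0, after
    inserting \<open>G ?p\<close>, \<open>W ?p\<close> and the derivatives \<open>G'\<close> and
    \<open>W'\<close>; all remaining powers of \<open>T\<close> outside \<open>kropina_speed\<close>
    cancel.\<close>
  let ?d = "2 * kropina_speed * (- (M' / k) + ?f * N' / (2 * k\<^sup>2))"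
  have "((\<lambda>r. G (r, s)) has_real_derivative 2 * T * M') (at 0)"
    "((\<lambda>r. W (r, s)) has_real_derivative N') (at 0)"
    using has_vector_derivative_partials(1)[OF D(1)] has_vector_derivative_partials(1)[OF D(3)] G' W'
    by (simp_all add: has_real_derivative_iff_has_vector_derivative)
  then have "((\<lambda>r. (- (G (r, s) / (2 * W (r, s))))\<^sup>2) has_real_derivative
      2 * (- (G ?p / (2 * W ?p))) * - ((2 * T * M' * (2 * W ?p) - G ?p * (2 * N')) / ((2 * W ?p) * (2 * W ?p)))) (at 0)"
    using W0 T k(1) by (auto intro!: derivative_eq_intros simp: mult_ac)
  also have "2 * (- (G ?p / (2 * W ?p))) * - ((2 * T * M' * (2 * W ?p) - G ?p * (2 * N')) / ((2 * W ?p) * (2 * W ?p))) = ?d"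
    using T k(1) unfolding W0 G0 kropina_speed_def by (simp add: field_simps power2_eq_square)
  finally have d1: "((\<lambda>r. (- (G (r, s) / (2 * W (r, s))))\<^sup>2) has_real_derivative ?d) (at 0)" .
  have d2: "open (I \<inter> (\<lambda>r. (r, s)) -` U)"
    using I(1) U(1) by (intro open_Int open_vimage continuous_intros) auto
  have d3: "(- (G (r, s) / (2 * W (r, s))))\<^sup>2 = (kropina g \<omega> (H r s) (velocity_within (H r) {a..b} s))\<^sup>2"
    if "r \<in> I \<inter> (\<lambda>r. (r, s)) -` U" for r
  proof -
    from that have rU: "(r, s) \<in> U" "r \<in> I" by auto
    have "velocity_within (H r) {a..b} s = chart_vec \<A> c (H r s) (A (r, s))"
      unfolding A_def by (rule velocity_within_eq[OF Hs[OF rU s] at_within_Icc_neq_bot[OF ab(2) s]])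
    then show ?thesis
      using kropina_eq_rep[OF c dom[OF rU s]] F[OF rU s] by (simp add: G_def W_def gm_def om_def)
  qed
  have d: "((\<lambda>r. (kropina g \<omega> (H r s) (velocity_within (H r) {a..b} s))\<^sup>2) has_real_derivative ?d) (at 0)"
    by (rule has_field_derivative_transform_within_open[OF d1 d2 _ d3]) (use U(2) I(3) in auto)
  have "((\<lambda>s. M (0, s)) has_real_derivative M') (at s within {a..b})"
    "((\<lambda>s. N (0, s)) has_real_derivative N') (at s within {a..b})"
    using has_vector_derivative_partials(2)[OF D(2)] has_vector_derivative_partials(2)[OF D(4)]
    by (simp_all add: has_real_derivative_iff_has_vector_derivative M'_def N'_def)
  then have "((\<lambda>s. 2 * kropina_speed * (- (M (0, s) / k) + ?f * N (0, s) / (2 * k\<^sup>2))) has_real_derivative ?d) (at s within {a..b})"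
    by (intro DERIV_cmult DERIV_add DERIV_minus DERIV_cdivide)
  then have "((\<lambda>s. 2 * kropina_speed * (- (M (0, s) / k) + ?f * N (0, s) / (2 * k\<^sup>2))) has_vector_derivative ?d) (at s within {a..b})"
    by (simp add: has_real_derivative_iff_has_vector_derivative)
  moreover have "open ((\<lambda>s. (0, s)) -` U)"
    using U(1) by (intro open_vimage continuous_intros) auto
  ultimately have "(boundary_term has_vector_derivative ?d) (at s within {a..b})"
  proof (rule has_vector_derivative_transform_eventually[OF _ _ _ s])
    fix t assume "t \<in> {a..b} \<inter> (\<lambda>s. (0, s)) -` U"
    then have t: "(0, t) \<in> U" "t \<in> {a..b}" by auto
    have pt: "H 0 t \<in> chart_dom c" "H 0 t \<in> S" using dom[OF t(1) I(3) t(2)] chart_dom_subset[OF c] by auto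
    have "variation_field t = chart_vec \<A> c (H 0 t) (R (0, t))"
      unfolding variation_field_def R_def
      by (rule velocity_within_eq[OF Hr[OF t(1) I(3) t(2)]]) (use at_within_open[OF I(3,1)] in simp)
    moreover have "\<omega> (H 0 t) (chart_vec \<A> c (H 0 t) (R (0, t))) = N (0, t)"
      using form_eq_rep[OF c pt(1) chart_vec_in_tangent_space[OF c pt(1)]]
      by (simp add: N_def om_def F[OF t(1) I(3) t(2)] chart_vec_self c pt)
    moreover have "g (H 0 t) (chart_vec \<A> c (H 0 t) (R (0, t))) (Y (H 0 t)) = M (0, t)"
      using metric_eq_rep[OF c pt(1) chart_vec_in_tangent_space[OF c pt(1)] Y_tangent[OF pt(2)]]
      by (simp add: M_def gm_def y_def F[OF t(1) I(3) t(2)] chart_vec_self vec_rep_coord c pt)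
    ultimately show "2 * kropina_speed * (- (M (0, t) / k) + ?f * N (0, t) / (2 * k\<^sup>2)) = boundary_term t"
      by (simp add: boundary_term_def)
  qed (use U(2) in auto)
  with d show ?thesis by (rule that)
qed

abbreviation integrand :: "real \<Rightarrow> real \<Rightarrow> real" where
  "integrand r s \<equiv> (kropina g \<omega> (H r s) (velocity \<A> (H r) s))\<^sup>2"

text \<open>Differentiation under the integral turns the left side into the integral of the
  pointwise derivative, which is the s-derivative of the boundary term; the fundamental theorem of
  calculus leaves the two endpoint values.\<close>

lemma piece_first_variation:
  assumes ab: "0 \<le> a" "a < b" "b \<le> 1" and H: "smooth_into S \<A> (I \<times> {a..b}) (\<lambda>(r, s). H r s)"
  shows "r \<in> I \<Longrightarrow> integrand r integrable_on {a..b}"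
    and "((\<lambda>r. integral {a..b} (integrand r)) has_real_derivative boundary_term b - boundary_term a) (at 0)"
proof -
  define \<Phi> where "\<Phi> r s = (kropina g \<omega> (H r s) (velocity_within (H r) {a..b} s))\<^sup>2" for r s
  have "\<exists>d. ((\<lambda>r. \<Phi> r s) has_real_derivative d) (at 0) \<and>
      (boundary_term has_vector_derivative d) (at s within {a..b})" if "s \<in> {a..b}" for s
    unfolding \<Phi>_def by (rule pointwise_first_variation[OF ab H that]) blast
  then obtain D where D: "\<And>s. s \<in> {a..b} \<Longrightarrow> ((\<lambda>r. \<Phi> r s) has_real_derivative D s) (at 0)"
    "\<And>s. s \<in> {a..b} \<Longrightarrow> (boundary_term has_vector_derivative D s) (at s within {a..b})"
    by metis
  have loc: "\<exists>U \<Psi>. open U \<and> (r0, s0) \<in> U \<and> Ck_on 1 U \<Psi> \<and>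
      (\<forall>r s. (r, s) \<in> U \<longrightarrow> r \<in> I \<longrightarrow> s \<in> {a..b} \<longrightarrow> \<Phi> r s = \<Psi> (r, s))"
    if rs0: "r0 \<in> I" "s0 \<in> {a..b}" for r0 s0
  proof -
    obtain c U F where c: "c \<in> \<A>" and U: "open U" "(r0, s0) \<in> U" "\<And>j. Ck_on j U F" "F ` U \<subseteq> chart_img c"
      and dom: "\<And>r s. (r, s) \<in> U \<Longrightarrow> r \<in> I \<Longrightarrow> s \<in> {a..b} \<Longrightarrow> H r s \<in> chart_dom c"
      and F: "\<And>r s. (r, s) \<in> U \<Longrightarrow> r \<in> I \<Longrightarrow> s \<in> {a..b} \<Longrightarrow> F (r, s) = coord c (H r s)"
      and Hs: "\<And>r s. (r, s) \<in> U \<Longrightarrow> r \<in> I \<Longrightarrow> s \<in> {a..b} \<Longrightarrow>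
        has_velocity \<A> (H r) (chart_vec \<A> c (H r s) (frechet_derivative F (at (r, s)) (0, 1))) s {a..b}"
      by (rule variation_chart[OF ab(2) H rs0]) (rule that; assumption)
    define A where "A q = frechet_derivative F (at q) (0, 1)" for q
    define G where "G q = metric_rep \<A> c g (F q) (A q) (A q)" for q
    define W where "W q = form_rep \<A> c \<omega> (F q) (A q)" for q
    have A: "Ck_on 1 U A"
      using U(3)[of 2] by (simp add: numeral_2_eq_2 A_def[abs_def])
    note V = open_chart_img[OF c]
    have G: "Ck_on 1 U G"
      unfolding G_def[abs_def]
      by (rule Ck_on_metric_field[OF U(1) V U(4) linear_metric_rep1[OF c] linear_metric_rep2[OF c] Ck_on_metric_rep[OF c] U(3) A A])
    have W: "Ck_on 1 U W"
      unfolding W_def[abs_def]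
      by (rule Ck_on_form_field[OF U(1) V U(4) linear_form_rep[OF c] Ck_on_form_rep[OF c] U(3) A])
    have W0: "W (r, s) < 0" if "(r, s) \<in> U" "r \<in> I" "s \<in> {a..b}" for r s
      using admissible_loop_velocity[OF H_admissible ab _ Hs] that F
      by (simp add: W_def A_def form_rep_def chart_inv_coord[OF c dom])
    \<comment> \<open>The extension is also defined outside the strip, where admissibility says
      nothing about the sign of \<open>W\<close>; the neighbourhood is therefore cut down to where
      \<open>W\<close> is nonzero.\<close>
    let ?U = "U \<inter> W -` (- {0})"
    let ?\<Psi> = "\<lambda>q. G q * inverse (2 * W q) * (G q * inverse (2 * W q))"
    have o1: "open ?U"
      using continuous_open_preimage[OF Ck_on_imp_continuous_on[OF W] U(1)] by blast
    have o2: "(r0, s0) \<in> ?U" using U(2) W0[OF U(2) rs0] by auto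
    have o3: "Ck_on 1 ?U ?\<Psi>"
      using Ck_on_subset[OF G, of ?U] Ck_on_subset[OF W, of ?U] o1
      by (intro Ck_on_mult Ck_on_inverse Ck_on_const) auto
    have o4: "\<Phi> r s = ?\<Psi> (r, s)"
      if "(r, s) \<in> ?U" "r \<in> I" "s \<in> {a..b}" for r s
    proof -
      have rs: "(r, s) \<in> U" using that by auto
      have "velocity_within (H r) {a..b} s = chart_vec \<A> c (H r s) (A (r, s))"
        unfolding A_def by (rule velocity_within_eq[OF Hs at_within_Icc_neq_bot]) (use rs that ab in auto)
      then have "\<Phi> r s = (- (G (r, s) / (2 * W (r, s))))\<^sup>2"
        using kropina_eq_rep[OF c dom[OF rs that(2,3)]] F[OF rs that(2,3)]
        by (simp add: \<Phi>_def G_def W_def)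
      then show ?thesis
        by (simp only: power2_eq_square divide_inverse minus_mult_minus)
    qed
    show ?thesis
      by (intro exI[of _ ?U] exI[of _ ?\<Psi>] conjI o1 o2 o3 allI impI o4)
  qed
  \<comment> \<open>At interior points both derivatives are two-sided and agree. At \<open>a\<close>
    and \<open>b\<close> \<open>velocity\<close> may be meaningless, but two points do not affect
    the integral.\<close>
  have eq: "integrand r s = \<Phi> r s" if "s \<in> {a..b} - {a, b}" for r s
  proof -
    have "at s within {0..1} = at s" "at s within {a..b} = at s"
      using that ab by (auto intro!: at_within_interior)
    then have "velocity \<A> (H r) s = velocity_within (H r) {a..b} s"
      unfolding velocity_def velocity_within_def by (intro ext) auto
    then show ?thesis by (simp add: \<Phi>_def)
  qed
  have "\<Phi> r integrable_on {a..b}" if "r \<in> I" for r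
    using leibniz_rule_locally_C1(1)[OF I loc D(1) that] .
  then show "r \<in> I \<Longrightarrow> integrand r integrable_on {a..b}"
    using integrable_spike_finite[of "{a, b}" "{a..b}" "integrand r" "\<Phi> r"] eq by auto
  have "(D has_integral boundary_term b - boundary_term a) {a..b}"
    using fundamental_theorem_of_calculus[OF _ D(2)] ab by simp
  moreover have "integral {a..b} (integrand r) = integral {a..b} (\<Phi> r)" for r
    by (rule integral_spike[of "{a, b}"]) (use eq in auto)
  ultimately show "((\<lambda>r. integral {a..b} (integrand r)) has_real_derivative boundary_term b - boundary_term a) (at 0)"
    using leibniz_rule_locally_C1(2)[OF I loc D(1)] by (simp add: integral_unique)
qed

text \<open>Boundary terms telescope over the subdivision, since the value at a corner is the same
  seen from either side. The induction counts the subdivision points to the left of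
  \<open>t\<close>.\<close>

lemma first_variation_upto:
  assumes P: "subdivision P"
    and H: "\<And>a b. consecutive P a b \<Longrightarrow> smooth_into S \<A> (I \<times> {a..b}) (\<lambda>(r, s). H r s)"
    and t: "t \<in> P"
  shows "(\<forall>r\<in>I. integrand r integrable_on {0..t}) \<and>
    ((\<lambda>r. integral {0..t} (integrand r)) has_real_derivative boundary_term t - boundary_term 0) (at 0)"
  using t
proof (induction "card (P \<inter> {..<t})" arbitrary: t rule: less_induct)
  case less
  have fin: "finite P" and P01: "0 \<in> P" "P \<subseteq> {0..1}"
    using P by (auto simp: subdivision_def)
  show ?case
  proof (cases "t = 0")
    case False
    then have t0: "0 < t" using less.prems P01 by fastforce
    let ?Q = "P \<inter> {..<t}"
    \<comment> \<open>The predecessor of \<open>t\<close> in the subdivision: the induction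
      hypothesis covers \<open>{0..a}\<close>, and the smooth piece \<open>{a..t}\<close> is
      added.\<close>
    define a where "a = Max ?Q"
    have aQ: "a \<in> ?Q" unfolding a_def using fin P01 t0 by (intro Max_in) auto
    have amax: "x \<le> a" if "x \<in> ?Q" for x unfolding a_def using fin that by (intro Max_ge) auto
    have cons: "consecutive P a t"
      using aQ amax less.prems unfolding consecutive_def by force
    have a: "0 \<le> a" "a < t" "t \<le> 1" using aQ P01 less.prems by auto
    have "card (P \<inter> {..<a}) < card ?Q"
      using aQ fin by (intro psubset_card_mono) auto
    then have IH: "\<And>r. r \<in> I \<Longrightarrow> integrand r integrable_on {0..a}"
      "((\<lambda>r. integral {0..a} (integrand r)) has_real_derivative boundary_term a - boundary_term 0) (at 0)"
      using less.hyps aQ by auto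
    note piece = piece_first_variation[OF a H[OF cons]]
    have int: "integrand r integrable_on {0..t}" if "r \<in> I" for r
      using Henstock_Kurzweil_Integration.integrable_combine[OF a(1) less_imp_le[OF a(2)] IH(1)[OF that] piece(1)[OF that]] .
    have "((\<lambda>r. integral {0..a} (integrand r) + integral {a..t} (integrand r)) has_real_derivative
        boundary_term t - boundary_term 0) (at 0)"
      using DERIV_add[OF IH(2) piece(2)] by simp
    then have "((\<lambda>r. integral {0..t} (integrand r)) has_real_derivative boundary_term t - boundary_term 0) (at 0)"
      by (rule has_field_derivative_transform_within_open[OF _ I(1,3)])
        (use a int in \<open>auto intro!: Henstock_Kurzweil_Integration.integral_combine\<close>)
    with int show ?thesis by blast
  qed (auto simp: integrable_on_refl[of _ "0::real", simplified])
qed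

lemma kropina_energy_first_variation:
  "((\<lambda>r. kropina_energy \<A> g \<omega> (H r)) has_real_derivative 0) (at 0)"
proof -
  obtain P where P: "subdivision P" "\<And>a b. consecutive P a b \<Longrightarrow> smooth_into S \<A> (I \<times> {a..b}) (\<lambda>(r, s). H r s)"
    using variation unfolding admissible_variation_def I_def by blast
  have "1 \<in> P" using P by (auto simp: subdivision_def)
  from first_variation_upto[OF P this] boundary_term_1
  have "((\<lambda>r. integral {0..1} (integrand r)) has_real_derivative 0) (at 0)" by simp
  from DERIV_cmult[OF this, of "1 / 2"] show ?thesis
    unfolding kropina_energy_def by simp
qed

end

section \<open>Closed orbits as geodesics\<close>

context kropina_killing
begin

lemma open_orbit_chart_dom:
  assumes \<gamma>: "continuous_on UNIV \<gamma>" "range \<gamma> \<subseteq> S" and c: "c \<in> \<A>"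
  shows "open {s :: real. \<gamma> s \<in> chart_dom c}"
proof (subst open_subopen, intro ballI)
  fix s assume "s \<in> {s. \<gamma> s \<in> chart_dom c}"
  then have s: "\<gamma> s \<in> chart_dom c" by simp
  obtain N where "open N" "s \<in> N" "\<And>x. x \<in> UNIV \<inter> N \<Longrightarrow> \<gamma> x \<in> chart_dom c"
    by (rule continuous_into_chart_dom[OF \<gamma> c UNIV_I s]) (rule that; assumption)
  then show "\<exists>N. open N \<and> s \<in> N \<and> N \<subseteq> {s. \<gamma> s \<in> chart_dom c}" by blast
qed

text \<open>An integral curve is only assumed continuous with the prescribed velocity. Its
  coordinate expression solves an autonomous equation with smooth right side, so each order of
  regularity yields the next.\<close>

lemma scaled_orbit_smooth_into:
  assumes \<gamma>: "complete_integral_curve S \<A> Y \<gamma>"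
  shows "smooth_into S \<A> X (\<lambda>s. \<gamma> (T * s))"
proof -
  have \<gamma>': "range \<gamma> \<subseteq> S" "continuous_on UNIV \<gamma>"
    using \<gamma> unfolding complete_integral_curve_def by auto
  have cont: "continuous_on UNIV (\<lambda>s. \<gamma> (T * s))"
    by (rule continuous_on_compose2[OF \<gamma>'(2)]) (auto intro!: continuous_intros)
  have "smooth_on {s \<in> X. \<gamma> (T * s) \<in> chart_dom c} (coord c \<circ> (\<lambda>s. \<gamma> (T * s)))" if c: "c \<in> \<A>" for c
  proof -
    let ?U = "{s. \<gamma> (T * s) \<in> chart_dom c}" let ?F = "coord c \<circ> (\<lambda>s. \<gamma> (T * s))"
    have U: "open ?U"
      by (rule open_orbit_chart_dom[OF cont _ c]) (use \<gamma>' in auto)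
    have F: "(?F has_derivative (\<lambda>h. h *\<^sub>R (T *\<^sub>R vec_rep c Y (?F s)))) (at s)" if "s \<in> ?U" for s
      using scaled_orbit_has_velocity[OF \<gamma> UNIV_I, of T s] c that
      unfolding has_velocity_def has_vector_derivative_def by (auto simp: vec_rep_coord)
    have "Ck_on j ?U ?F" for j
    proof (induction j)
      case 0
      then show ?case
        unfolding Ck_on.simps by (intro continuous_at_imp_continuous_on ballI has_derivative_continuous[OF F])
    next
      case (Suc j)
      have "Ck_on j ?U (\<lambda>s. vec_rep c Y (?F s))"
        by (rule Ck_on_compose[OF U open_chart_img[OF c] Suc _ Ck_on_vec_rep[OF c]])
          (use c in \<open>auto simp: coord_in_chart_img\<close>)
      then show ?case
        by (intro Ck_on_SucI[OF U F] Ck_on_scaleR Ck_on_const U)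
    qed
    with U show ?thesis unfolding smooth_on_def by blast
  qed
  with \<gamma>' cont show ?thesis
    unfolding smooth_into_def by (auto intro: continuous_on_subset)
qed

lemma closed_geodesic_orbit:
  assumes \<gamma>: "complete_integral_curve S \<A> Y \<gamma>" and T: "T > 0" "\<And>t. \<gamma> (t + T) = \<gamma> t"
    and crit: "\<And>t. critical (\<gamma> t)"
  shows "closed_geodesic S \<A> g \<omega> (\<lambda>s. \<gamma> (T * s))"
proof -
  let ?\<gamma> = "\<lambda>s. \<gamma> (T * s)"
  have S: "\<gamma> t \<in> S" for t using \<gamma> unfolding complete_integral_curve_def by auto
  have nat: "\<gamma> (t + of_nat n * T) = \<gamma> t" for t n
  proof (induction n)
    case (Suc n)
    have "t + of_nat (Suc n) * T = t + of_nat n * T + T" by (simp add: distrib_right)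
    then show ?case by (simp only: T(2) Suc)
  qed simp
  have int: "\<gamma> (t + of_int n * T) = \<gamma> t" for t n
  proof (cases "n \<ge> 0")
    case True
    then show ?thesis using nat[of t "nat n"] by simp
  next
    case False
    then show ?thesis using nat[of "t + of_int n * T" "nat (- n)"] by simp
  qed
  \<comment> \<open>Periodicity makes \<open>periodic_ext\<close> return the orbit itself, so no
    corner arises at the base point and the one-sided conditions at 0 and 1 are met.\<close>
  have "\<gamma> (T * frac t) = \<gamma> (T * t)" for t
    using int[of "T * frac t" "\<lfloor>t\<rfloor>"] by (simp add: frac_def algebra_simps)
  then have ext: "periodic_ext ?\<gamma> = ?\<gamma>"
    by (simp add: periodic_ext_def fun_eq_iff)
  have vel: "\<exists>v\<in>kropina_domain \<A> \<omega> (?\<gamma> s). has_velocity \<A> (periodic_ext ?\<gamma>) v s X" if "s \<in> X" for s X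
  proof (intro bexI)
    show v: "has_velocity \<A> (periodic_ext ?\<gamma>) (\<lambda>c. T *\<^sub>R Y (?\<gamma> s) c) s X"
      unfolding ext by (rule scaled_orbit_has_velocity[OF \<gamma> that])
    have "linear_on_tangent \<A> (?\<gamma> s) (\<omega> (?\<gamma> s))"
      using smooth_one_form S unfolding smooth_one_form_def by blast
    \<comment> \<open>\<open>linear_on_tangent\<close> only provides combinations of two vectors; a
      dummy summand with coefficient 0 extracts the scaling rule.\<close>
    then have "\<omega> (?\<gamma> s) (\<lambda>c. T *\<^sub>R Y (?\<gamma> s) c + 0 *\<^sub>R Y (?\<gamma> s) c) =
        T * \<omega> (?\<gamma> s) (Y (?\<gamma> s)) + 0 * \<omega> (?\<gamma> s) (Y (?\<gamma> s))"
      using Y_tangent[OF S] unfolding linear_on_tangent_def by blast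
    then have "\<omega> (?\<gamma> s) (\<lambda>c. T *\<^sub>R Y (?\<gamma> s) c) < 0"
      using k(2)[OF S] mult_pos_neg[OF T(1) k(1)] by simp
    then show "(\<lambda>c. T *\<^sub>R Y (?\<gamma> s) c) \<in> kropina_domain \<A> \<omega> (?\<gamma> s)"
      using v unfolding kropina_domain_def has_velocity_def ext by simp
  qed
  have smooth: "smooth_into S \<A> X ?\<gamma>" for X by (rule scaled_orbit_smooth_into[OF \<gamma>])
  have "piecewise_smooth S \<A> ?\<gamma>"
    unfolding piecewise_smooth_def using smooth
    by (intro exI[of _ "{0, 1}"]) (auto simp: subdivision_def)
  moreover have "continuous_on {0..1} ?\<gamma>" using smooth unfolding smooth_into_def by blast
  moreover have "?\<gamma> 0 = ?\<gamma> 1" using T(2)[of 0] by simp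
  ultimately have "?\<gamma> \<in> admissible_loops S \<A> \<omega>"
    unfolding admissible_loops_def using S vel by auto
  moreover have "((\<lambda>r. kropina_energy \<A> g \<omega> (H r)) has_real_derivative 0) (at 0)"
    if "\<epsilon> > 0" "admissible_variation S \<A> \<omega> ?\<gamma> \<epsilon> H" for \<epsilon> H
  proof -
    interpret orbit_variation S \<A> g \<omega> Y k \<gamma> T \<epsilon> H
      by unfold_locales (use \<gamma> T crit that in auto)
    show ?thesis by (rule kropina_energy_first_variation)
  qed
  ultimately show ?thesis unfolding closed_geodesic_def by blast
qed

text \<open>A constant orbit would force \<open>Y\<close> to vanish at a point, contradicting
  \<omega>(Y) = k < 0.\<close>

lemma scaled_orbit_not_constant:
  assumes \<gamma>: "complete_integral_curve S \<A> Y \<gamma>" and T: "T > 0"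
  shows "\<not> (\<lambda>s. \<gamma> (T * s)) constant_on {0..1}"
proof
  assume "(\<lambda>s. \<gamma> (T * s)) constant_on {0..1}"
  then obtain p where p: "\<And>s. s \<in> {0..1} \<Longrightarrow> \<gamma> (T * s) = p"
    unfolding constant_on_def by blast
  have pS: "p \<in> S" using p[of 0] \<gamma> unfolding complete_integral_curve_def by auto
  obtain c where c: "c \<in> \<A>" "p \<in> chart_dom c" using chart_cover[OF pS] by blast
  have "((coord c \<circ> (\<lambda>s. \<gamma> (T * s))) has_vector_derivative T *\<^sub>R Y p c) (at 0 within {0..1})"
    using scaled_orbit_has_velocity[OF \<gamma>, of 0 "{0..1}" T] c p[of 0] unfolding has_velocity_def by auto
  moreover have "((coord c \<circ> (\<lambda>s. \<gamma> (T * s))) has_vector_derivative 0) (at 0 within {0..1})"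
    by (rule has_vector_derivative_transform[OF _ _ has_vector_derivative_const[of "coord c p"]]) (use p in auto)
  ultimately have "T *\<^sub>R Y p c = 0"
    by (rule vector_derivative_unique_within[OF at_within_Icc_neq_bot, rotated 2]) auto
  then have "\<omega> p (Y p) = 0"
    using form_eq_rep[OF c Y_tangent[OF pS]] linear_0[OF linear_form_rep[OF c(1) coord_in_chart_img[OF c]]] T by simp
  with k pS show False by simp
qed

text \<open>The part of an orbit inside a chart is a differentiable image of a subset of the line,
  hence negligible in dimension at least 2, whereas the chart image is open and nonempty.\<close>

lemma orbit_not_onto:
  assumes \<gamma>: "complete_integral_curve S \<A> Y \<gamma>" and dim: "DIM('b) \<ge> 2"
  shows "\<exists>q\<in>S. q \<notin> range \<gamma>"
proof (rule ccontr)
  assume "\<not> (\<exists>q\<in>S. q \<notin> range \<gamma>)"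
  then have onto: "S \<subseteq> range \<gamma>" by blast
  have \<gamma>': "range \<gamma> \<subseteq> S" "\<And>t. has_velocity \<A> \<gamma> (Y (\<gamma> t)) t UNIV"
    using \<gamma> unfolding complete_integral_curve_def by auto
  obtain c where c: "c \<in> \<A>" "\<gamma> 0 \<in> chart_dom c" using chart_cover \<gamma>'(1) by blast
  let ?U = "{t. \<gamma> t \<in> chart_dom c}"
  have "(coord c \<circ> \<gamma>) differentiable_on ?U"
    unfolding differentiable_on_def
    using \<gamma>'(2) c(1) unfolding has_velocity_def
    by (auto intro: differentiable_at_withinI differentiableI_vector)
  then have "negligible ((coord c \<circ> \<gamma>) ` ?U)"
    using dim by (intro negligible_differentiable_image_lowdim) auto
  moreover have "chart_img c \<subseteq> (coord c \<circ> \<gamma>) ` ?U"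
    using onto chart_dom_subset[OF c(1)] unfolding chart_img_def by (auto simp: image_iff)
  ultimately have "negligible (chart_img c)" using negligible_subset by blast
  then show False
    using open_not_negligible[OF open_chart_img[OF c(1)]] coord_in_chart_img[OF c] by auto
qed

text \<open>The conclusion provides a starting point of the second orbit that the first orbit
  misses, since a difference of images is what no reparametrization can remove.\<close>

lemma exists_extremal_orbits:
  assumes "compact S" "S \<noteq> {}" "DIM('b) \<ge> 2" and orbits: "\<And>p. p \<in> S \<Longrightarrow> complete_integral_curve S \<A> Y (\<gamma> p) \<and> \<gamma> p 0 = p"
  obtains p q where "p \<in> S" "q \<in> S" "q \<notin> range (\<gamma> p)" "\<And>t. critical (\<gamma> p t)" "\<And>t. critical (\<gamma> q t)"
proof -
  let ?f = energy_density
  have const: "?f (\<gamma> p t) = ?f p" if "p \<in> S" for p t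
    using energy_density_orbit[of "\<gamma> p" t] orbits[OF that] by simp
  obtain p where p: "p \<in> S" "\<forall>x\<in>S. ?f x \<le> ?f p"
    using continuous_attains_sup[OF assms(1,2) continuous_on_energy_density] by blast
  obtain q where q: "q \<in> S" "\<forall>x\<in>S. ?f q \<le> ?f x"
    using continuous_attains_inf[OF assms(1,2) continuous_on_energy_density] by blast
  have pc: "critical (\<gamma> p t)" for t
    by (rule extremal_imp_critical) (use p const in auto)
  have qc: "critical (\<gamma> q t)" for t
    by (rule extremal_imp_critical) (use q const in auto)
  show ?thesis
  proof (cases "?f p = ?f q")
    case True
    obtain q' where q': "q' \<in> S" "q' \<notin> range (\<gamma> p)"
      using orbit_not_onto assms(3) orbits[OF p(1)] by blast
    have "?f x = ?f p" if "x \<in> S" for x using p q that True by force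
    then have "critical (\<gamma> q' t)" for t
      by (intro extremal_imp_critical) (use q' const in auto)
    with p q' pc show ?thesis using that by blast
  next
    case False
    then have "q \<notin> range (\<gamma> p)" using const[OF p(1)] by auto
    with p q pc qc show ?thesis using that by blast
  qed
qed

end

theorem theorem5p6:
  fixes S :: "'a::topological_space set"
    and \<A> :: "('a, 'b::euclidean_space) chart set"
    and g\<^sub>0 :: "'a \<Rightarrow> ('a, 'b) tangent \<Rightarrow> ('a, 'b) tangent \<Rightarrow> real"
    and \<omega> :: "'a \<Rightarrow> ('a, 'b) tangent \<Rightarrow> real"
    and Y :: "'a \<Rightarrow> ('a, 'b) tangent"
    and k :: real
  assumes "smooth_manifold S \<A>"
    and "connected S"
    and "DIM('b) \<ge> 2"
    and "compact S"
    and "riemannian_metric S \<A> g\<^sub>0"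
    and "killing_field S \<A> g\<^sub>0 Y"
    and "periodic_field S \<A> Y"
    and "\<exists>p\<in>S. Y p \<noteq> (\<lambda>c. 0)"
    and "smooth_one_form S \<A> \<omega>"
    and "k < 0" and "\<forall>p\<in>S. \<omega> p (Y p) = k"
    and "lie_form_zero \<A> Y \<omega>"
  shows "\<exists>\<gamma>\<^sub>1 \<gamma>\<^sub>2.
    closed_geodesic S \<A> g\<^sub>0 \<omega> \<gamma>\<^sub>1 \<and> \<not> \<gamma>\<^sub>1 constant_on {0..1} \<and>
    closed_geodesic S \<A> g\<^sub>0 \<omega> \<gamma>\<^sub>2 \<and> \<not> \<gamma>\<^sub>2 constant_on {0..1} \<and>
    \<not> same_up_to_reparametrization \<gamma>\<^sub>1 \<gamma>\<^sub>2"
proof -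
  interpret kropina_killing S \<A> g\<^sub>0 \<omega> Y k
    by unfold_locales (use assms in auto)
  have "\<forall>p\<in>S. \<exists>\<gamma> T. (complete_integral_curve S \<A> Y \<gamma> \<and> \<gamma> 0 = p) \<and> T > 0 \<and> (\<forall>t. \<gamma> (t + T) = \<gamma> t)"
    using assms(7) unfolding periodic_field_def by blast
  then obtain \<gamma> T where \<gamma>: "\<And>p. p \<in> S \<Longrightarrow> complete_integral_curve S \<A> Y (\<gamma> p) \<and> \<gamma> p 0 = p"
    and T: "\<And>p. p \<in> S \<Longrightarrow> T p > 0" "\<And>p t. p \<in> S \<Longrightarrow> \<gamma> p (t + T p) = \<gamma> p t"
    by metis
  have "S \<noteq> {}" using assms(8) by blast
  then obtain p q where pq: "p \<in> S" "q \<in> S" "q \<notin> range (\<gamma> p)"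
    and crit: "\<And>t. critical (\<gamma> p t)" "\<And>t. critical (\<gamma> q t)"
    by (rule exists_extremal_orbits[OF assms(4) _ assms(3) \<gamma>]) (assumption, (rule that; assumption))
  let ?\<gamma>1 = "\<lambda>s. \<gamma> p (T p * s)" and ?\<gamma>2 = "\<lambda>s. \<gamma> q (T q * s)"
  have "closed_geodesic S \<A> g\<^sub>0 \<omega> ?\<gamma>1" "closed_geodesic S \<A> g\<^sub>0 \<omega> ?\<gamma>2"
    using closed_geodesic_orbit \<gamma> T pq crit by blast+
  moreover have "\<not> ?\<gamma>1 constant_on {0..1}" "\<not> ?\<gamma>2 constant_on {0..1}"
    using scaled_orbit_not_constant \<gamma> T pq by blast+
  moreover have "\<not> same_up_to_reparametrization ?\<gamma>1 ?\<gamma>2"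
  proof
    assume "same_up_to_reparametrization ?\<gamma>1 ?\<gamma>2"
    then obtain \<phi> where "\<forall>t. periodic_ext ?\<gamma>2 t = periodic_ext ?\<gamma>1 (\<phi> t)"
      unfolding same_up_to_reparametrization_def by blast
    \<comment> \<open>At parameter 0 the second loop is at \<open>q\<close>, while the first loop
      stays in \<open>range (\<gamma> p)\<close> whatever \<open>\<phi>\<close> is.\<close>
    from spec[OF this, of 0] have "q \<in> range (\<gamma> p)"
      using \<gamma>[OF pq(2)] by (auto simp: periodic_ext_def)
    with pq(3) show False by blast
  qed
  ultimately show ?thesis by blast
qed

end
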